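(* Let $M=(M^{2n+s},f,\xi_i,\eta_i,g)$ be a trans-$S$-manifold with associated smooth functions $\alpha_i,\beta_i$ ($i=1,\dots,s$), and let $\gamma:I\to M$ be a Legendre Frenet curve of osculating order $r=2$ with Frenet frame $\{T,E_2\}$ and curvature $\kappa_1$. Then $\gamma$ is $C$-parallel in the normal bundle, with non-zero function $\lambda$, if and only if $$\kappa_1=\mp\sqrt{s}\,\beta,\qquad \lambda=-\beta',\qquad \sum_{i=1}^s\xi_i=\pm\sqrt{s}\,E_2$$ along $\gamma$ (upper signs together or lower signs together). In this case $\beta_1=\beta_2=\dots=\beta_s=\beta$ along $\gamma$, which is the meaning of $\beta$ in these equations.
   Context: A framed metric $f$-manifold $(M^{2n+s},f,\xi_i,\eta_i,g)$ is a $(2n+s)$-dimensional Riemannian manifold $(M,g)$ with a $(1,1)$-tensor field $f$ of rank $2n$, vector fields $\xi_1,\dots,\xi_s$ and 1-forms $\eta_1,\dots,\eta_s$ such that $f^2=-I+\sum_i\eta_i\otimes\xi_i$, $\eta_i(\xi_j)=\delta_{ij}$, $f\xi_i=0$, $\eta_i\circ f=0$, $g(fX,fY)=g(X,Y)-\sum_i\eta_i(X)\eta_i(Y)$, and $\eta_i(X)=g(X,\xi_i)$. It is normal if $[f,f]+2\sum_i d\eta_i\otimes\xi_i=0$, where $[f,f]$ is the Nijenhuis tensor of $f$ and $2d\eta(X,Y)=X\eta(Y)-Y\eta(X)-\eta([X,Y])$. A trans-$S$-manifold is a normal framed metric $f$-manifold for which there are smooth functions $\alpha_i,\beta_i$ ($i=1,\dots,s$)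 with $$(\nabla_Xf)Y=\sum_{i=1}^s\Big[\alpha_i\{g(fX,fY)\xi_i+\eta_i(Y)f^2X\}+\beta_i\{g(fX,Y)\xi_i-\eta_i(Y)fX\}\Big]$$ for all vector fields $X,Y$, where $\nabla$ is the Levi-Civita connection of $g$. A Frenet curve of osculating order $r$ is a unit-speed curve $\gamma$ with orthonormal fields $E_1=T=\gamma',E_2,\dots,E_r$ along $\gamma$ and positive functions $\kappa_1,\dots,\kappa_{r-1}$ on $I$ with $\nabla_TE_1=\kappa_1E_2$, $\nabla_TE_j=-\kappa_{j-1}E_{j-1}+\kappa_jE_{j+1}$ ($2\le j\le r-1$), $\nabla_TE_r=-\kappa_{r-1}E_{r-1}$. It is Legendre if $\eta_i(T)=0$ for all $i$. The mean curvature vector field is $H=\nabla_TT$; $\nabla^\perp$ is the normal connection along $\gamma$ (the component of $\nabla_T$ orthogonal to $T$). $\gamma$ is $C$-parallel in the normal bundle (with function $\lambda$) if $\nabla^\perp_TH=\lambda\sum_{i=1}^s\xi_i$ along $\gamma$, where $\lambda$ is a non-zero (nowhere vanishing) differentiable real-valued function on $I$. Functions $\alpha_i,\beta_i$ in equations along $\gamma$ mean their restrictions to $\gamma$, and $'$ is the derivative in the arc-length parameter. *)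

theory Defs
  imports "HOL-Analysis.Analysis" "HOL-Library.Function_Algebras"
begin

(* Tangent vectors will be functions on the set of charts, with pointwise operations. *)

instantiation "fun" :: (type, real_vector) real_vector
begin

definition scaleR_fun :: "real \<Rightarrow> ('a \<Rightarrow> 'b) \<Rightarrow> 'a \<Rightarrow> 'b"
  where "scaleR_fun r v = (\<lambda>x. r *\<^sub>R v x)"

instance
  by standard (auto simp: scaleR_fun_def fun_eq_iff scaleR_add_right scaleR_add_left)

end


section \<open>Smooth maps\<close>

(* Derivatives are taken within S, so that one definition serves open subsets of R^m and
   (unions of nondegenerate) intervals of the real line; in both cases they are unique. *)

fun C_k_on :: "nat \<Rightarrow> 'a::euclidean_space set \<Rightarrow> ('a \<Rightarrow> 'b::real_normed_vector) \<Rightarrow> bool" where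
  "C_k_on 0 S h \<longleftrightarrow> continuous_on S h"
| "C_k_on (Suc k) S h \<longleftrightarrow>
     h differentiable_on S \<and> (\<forall>v. C_k_on k S (\<lambda>x. frechet_derivative h (at x within S) v))"

definition smooth_on :: "'a::euclidean_space set \<Rightarrow> ('a \<Rightarrow> 'b::real_normed_vector) \<Rightarrow> bool"
  where "smooth_on S h \<longleftrightarrow> (\<forall>k. C_k_on k S h)"


section \<open>Smooth manifolds\<close>

(* The points of the manifold are all elements of the type 'a; its dimension is CARD('m).
   A chart is a pair of a domain and a coordinate map. The atlas need not be maximal. *)

type_synonym ('a, 'm) chart = "'a set \<times> ('a \<Rightarrow> real^'m)"

abbreviation chart_dom :: "('a, 'm) chart \<Rightarrow> 'a set"
  where "chart_dom c \<equiv> fst c"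

abbreviation chart_map :: "('a, 'm) chart \<Rightarrow> 'a \<Rightarrow> real^'m"
  where "chart_map c \<equiv> snd c"

abbreviation chart_img :: "('a, 'm) chart \<Rightarrow> (real^'m) set"
  where "chart_img c \<equiv> chart_map c ` chart_dom c"

definition chart_inv :: "('a, 'm) chart \<Rightarrow> real^'m \<Rightarrow> 'a"
  where "chart_inv c = inv_into (chart_dom c) (chart_map c)"

definition transition :: "('a, 'm) chart \<Rightarrow> ('a, 'm) chart \<Rightarrow> real^'m \<Rightarrow> real^'m"
  where "transition c d = chart_map d \<circ> chart_inv c"

definition smooth_manifold ::
  "('a::{t2_space,second_countable_topology}, 'm::finite) chart set \<Rightarrow> bool" where
  "smooth_manifold A \<longleftrightarrow>
     (\<Union>c\<in>A. chart_dom c) = UNIV \<and>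
     (\<forall>c\<in>A. open (chart_dom c) \<and> open (chart_img c) \<and>
        homeomorphism (chart_dom c) (chart_img c) (chart_map c) (chart_inv c)) \<and>
     (\<forall>c\<in>A. \<forall>d\<in>A.
        smooth_on (chart_map c ` (chart_dom c \<inter> chart_dom d)) (transition c d))"

definition smooth_function :: "('a, 'm::finite) chart set \<Rightarrow> ('a \<Rightarrow> real) \<Rightarrow> bool"
  where "smooth_function A h \<longleftrightarrow> (\<forall>c\<in>A. smooth_on (chart_img c) (h \<circ> chart_inv c))"


section \<open>Tangent vectors and tensor fields\<close>

(* A tangent vector v at p is the family of its coordinate vectors v c in all the charts c
   around p, related by the derivatives of the transition maps. The entries for charts that
   do not contain p are set to 0. *)

type_synonym ('a, 'm) tvec = "('a, 'm) chart \<Rightarrow> real^'m"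

definition tangent_space :: "('a, 'm::finite) chart set \<Rightarrow> 'a \<Rightarrow> ('a, 'm) tvec set" where
  "tangent_space A p =
     {v. (\<forall>c. \<not> (c \<in> A \<and> p \<in> chart_dom c) \<longrightarrow> v c = 0) \<and>
         (\<forall>c\<in>A. \<forall>d\<in>A. p \<in> chart_dom c \<inter> chart_dom d \<longrightarrow>
            v d = frechet_derivative (transition c d) (at (chart_map c p)) (v c))}"

(* The tangent vector at p whose coordinate vector in the chart c is x. *)

definition of_coords ::
  "('a, 'm::finite) chart set \<Rightarrow> ('a, 'm) chart \<Rightarrow> 'a \<Rightarrow> real^'m \<Rightarrow> ('a, 'm) tvec" where
  "of_coords A c p x =
     (\<lambda>d. if d \<in> A \<and> p \<in> chart_dom d
          then frechet_derivative (transition c d) (at (chart_map c p)) x else 0)"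

definition coord_vec ::
  "('a, 'm::finite) chart set \<Rightarrow> ('a, 'm) chart \<Rightarrow> 'm \<Rightarrow> 'a \<Rightarrow> ('a, 'm) tvec"
  where "coord_vec A c i p = of_coords A c p (axis i 1)"

definition partial :: "('a, 'm::finite) chart \<Rightarrow> 'm \<Rightarrow> ('a \<Rightarrow> real) \<Rightarrow> 'a \<Rightarrow> real" where
  "partial c i h p = frechet_derivative (h \<circ> chart_inv c) (at (chart_map c p)) (axis i 1)"

definition smooth_vector_field ::
  "('a, 'm::finite) chart set \<Rightarrow> ('a \<Rightarrow> ('a, 'm) tvec) \<Rightarrow> bool" where
  "smooth_vector_field A X \<longleftrightarrow>
     (\<forall>p. X p \<in> tangent_space A p) \<and>
     (\<forall>c\<in>A. smooth_on (chart_img c) ((\<lambda>p. X p c) \<circ> chart_inv c))"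

definition linear_on_space :: "'v::real_vector set \<Rightarrow> ('v \<Rightarrow> 'w::real_vector) \<Rightarrow> bool" where
  "linear_on_space V h \<longleftrightarrow>
     (\<forall>v\<in>V. \<forall>w\<in>V. h (v + w) = h v + h w) \<and> (\<forall>r. \<forall>v\<in>V. h (r *\<^sub>R v) = r *\<^sub>R h v)"

definition one_form ::
  "('a, 'm::finite) chart set \<Rightarrow> ('a \<Rightarrow> ('a, 'm) tvec \<Rightarrow> real) \<Rightarrow> bool" where
  "one_form A \<eta> \<longleftrightarrow>
     (\<forall>p. linear_on_space (tangent_space A p) (\<eta> p)) \<and>
     (\<forall>c\<in>A. \<forall>j. smooth_on (chart_img c) ((\<lambda>p. \<eta> p (coord_vec A c j p)) \<circ> chart_inv c))"

definition tensor_field_1_1 ::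
  "('a, 'm::finite) chart set \<Rightarrow> ('a \<Rightarrow> ('a, 'm) tvec \<Rightarrow> ('a, 'm) tvec) \<Rightarrow> bool" where
  "tensor_field_1_1 A f \<longleftrightarrow>
     (\<forall>p. f p ` tangent_space A p \<subseteq> tangent_space A p \<and>
          linear_on_space (tangent_space A p) (f p)) \<and>
     (\<forall>c\<in>A. \<forall>j. smooth_on (chart_img c) ((\<lambda>p. f p (coord_vec A c j p) c) \<circ> chart_inv c))"

definition riemannian_metric ::
  "('a, 'm::finite) chart set \<Rightarrow> ('a \<Rightarrow> ('a, 'm) tvec \<Rightarrow> ('a, 'm) tvec \<Rightarrow> real) \<Rightarrow> bool" where
  "riemannian_metric A g \<longleftrightarrow>
     (\<forall>p. \<forall>v\<in>tangent_space A p.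
        linear_on_space (tangent_space A p) (g p v) \<and>
        (\<forall>w\<in>tangent_space A p. g p v w = g p w v) \<and>
        (v \<noteq> 0 \<longrightarrow> g p v v > 0)) \<and>
     (\<forall>c\<in>A. \<forall>i j.
        smooth_on (chart_img c)
          ((\<lambda>p. g p (coord_vec A c i p) (coord_vec A c j p)) \<circ> chart_inv c))"


section \<open>Differential operators\<close>

(* The operators below are evaluated at p in one chosen chart around p; for smooth arguments
   the result does not depend on the choice. *)

definition chart_at :: "('a, 'm) chart set \<Rightarrow> 'a \<Rightarrow> ('a, 'm) chart"
  where "chart_at A p = (SOME c. c \<in> A \<and> p \<in> chart_dom c)"

definition dir_deriv ::
  "('a, 'm::finite) chart set \<Rightarrow> ('a \<Rightarrow> ('a, 'm) tvec) \<Rightarrow> ('a \<Rightarrow> real) \<Rightarrow> 'a \<Rightarrow> real" where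
  "dir_deriv A X h p =
     (let c = chart_at A p in \<Sum>i\<in>UNIV. X p c $ i * partial c i h p)"

definition lie_bracket ::
  "('a, 'm::finite) chart set \<Rightarrow> ('a \<Rightarrow> ('a, 'm) tvec) \<Rightarrow> ('a \<Rightarrow> ('a, 'm) tvec) \<Rightarrow> 'a \<Rightarrow> ('a, 'm) tvec" where
  "lie_bracket A X Y p =
     (let c = chart_at A p in
      of_coords A c p
        (\<chi> k. \<Sum>i\<in>UNIV. X p c $ i * partial c i (\<lambda>q. Y q c $ k) p
                    - Y p c $ i * partial c i (\<lambda>q. X q c $ k) p))"

definition metric_matrix ::
  "('a, 'm::finite) chart set \<Rightarrow> ('a \<Rightarrow> ('a, 'm) tvec \<Rightarrow> ('a, 'm) tvec \<Rightarrow> real) \<Rightarrow>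
   ('a, 'm) chart \<Rightarrow> 'a \<Rightarrow> real^'m^'m" where
  "metric_matrix A g c p = (\<chi> i j. g p (coord_vec A c i p) (coord_vec A c j p))"

(* The Christoffel symbols, with upper index k, of the Levi-Civita connection of g. *)

definition christoffel ::
  "('a, 'm::finite) chart set \<Rightarrow> ('a \<Rightarrow> ('a, 'm) tvec \<Rightarrow> ('a, 'm) tvec \<Rightarrow> real) \<Rightarrow>
   ('a, 'm) chart \<Rightarrow> 'm \<Rightarrow> 'm \<Rightarrow> 'm \<Rightarrow> 'a \<Rightarrow> real" where
  "christoffel A g c k i j p =
     1/2 * (\<Sum>l\<in>UNIV. matrix_inv (metric_matrix A g c p) $ k $ l *
              (partial c i (\<lambda>q. metric_matrix A g c q $ j $ l) p
             + partial c j (\<lambda>q. metric_matrix A g c q $ i $ l) p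
             - partial c l (\<lambda>q. metric_matrix A g c q $ i $ j) p))"

definition connection_term ::
  "('a, 'm::finite) chart set \<Rightarrow> ('a \<Rightarrow> ('a, 'm) tvec \<Rightarrow> ('a, 'm) tvec \<Rightarrow> real) \<Rightarrow>
   ('a, 'm) chart \<Rightarrow> 'a \<Rightarrow> real^'m \<Rightarrow> real^'m \<Rightarrow> real^'m" where
  "connection_term A g c p x y =
     (\<chi> k. \<Sum>i\<in>UNIV. \<Sum>j\<in>UNIV. christoffel A g c k i j p * x $ i * y $ j)"

definition levi_civita ::
  "('a, 'm::finite) chart set \<Rightarrow> ('a \<Rightarrow> ('a, 'm) tvec \<Rightarrow> ('a, 'm) tvec \<Rightarrow> real) \<Rightarrow>
   ('a \<Rightarrow> ('a, 'm) tvec) \<Rightarrow> ('a \<Rightarrow> ('a, 'm) tvec) \<Rightarrow> 'a \<Rightarrow> ('a, 'm) tvec" where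
  "levi_civita A g X Y p =
     (let c = chart_at A p in
      of_coords A c p
        ((\<chi> k. \<Sum>i\<in>UNIV. X p c $ i * partial c i (\<lambda>q. Y q c $ k) p)
         + connection_term A g c p (X p c) (Y p c)))"

definition ext_deriv ::
  "('a, 'm::finite) chart set \<Rightarrow> ('a \<Rightarrow> ('a, 'm) tvec \<Rightarrow> real) \<Rightarrow>
   ('a \<Rightarrow> ('a, 'm) tvec) \<Rightarrow> ('a \<Rightarrow> ('a, 'm) tvec) \<Rightarrow> 'a \<Rightarrow> real" where
  "ext_deriv A \<eta> X Y p =
     1/2 * (dir_deriv A X (\<lambda>q. \<eta> q (Y q)) p - dir_deriv A Y (\<lambda>q. \<eta> q (X q)) p
            - \<eta> p (lie_bracket A X Y p))"

definition nijenhuis ::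
  "('a, 'm::finite) chart set \<Rightarrow> ('a \<Rightarrow> ('a, 'm) tvec \<Rightarrow> ('a, 'm) tvec) \<Rightarrow>
   ('a \<Rightarrow> ('a, 'm) tvec) \<Rightarrow> ('a \<Rightarrow> ('a, 'm) tvec) \<Rightarrow> 'a \<Rightarrow> ('a, 'm) tvec" where
  "nijenhuis A f X Y p =
     f p (f p (lie_bracket A X Y p))
     + lie_bracket A (\<lambda>q. f q (X q)) (\<lambda>q. f q (Y q)) p
     - f p (lie_bracket A (\<lambda>q. f q (X q)) Y p)
     - f p (lie_bracket A X (\<lambda>q. f q (Y q)) p)"


section \<open>Trans-S-manifolds\<close>

definition framed_metric_f_manifold ::
  "('a::{t2_space,second_countable_topology}, 'm::finite) chart set \<Rightarrow> nat \<Rightarrow> nat \<Rightarrow>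
   ('a \<Rightarrow> ('a, 'm) tvec \<Rightarrow> ('a, 'm) tvec) \<Rightarrow> (nat \<Rightarrow> 'a \<Rightarrow> ('a, 'm) tvec) \<Rightarrow>
   (nat \<Rightarrow> 'a \<Rightarrow> ('a, 'm) tvec \<Rightarrow> real) \<Rightarrow>
   ('a \<Rightarrow> ('a, 'm) tvec \<Rightarrow> ('a, 'm) tvec \<Rightarrow> real) \<Rightarrow> bool" where
  "framed_metric_f_manifold A n s f \<xi> \<eta> g \<longleftrightarrow>
     smooth_manifold A \<and> s \<ge> 1 \<and> CARD('m) = 2 * n + s \<and>
     riemannian_metric A g \<and> tensor_field_1_1 A f \<and>
     (\<forall>p. dim (f p ` tangent_space A p) = 2 * n) \<and>
     (\<forall>i\<in>{1..s}. smooth_vector_field A (\<xi> i) \<and> one_form A (\<eta> i)) \<and>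
     (\<forall>p. \<forall>v\<in>tangent_space A p. f p (f p v) = - v + (\<Sum>i=1..s. \<eta> i p v *\<^sub>R \<xi> i p)) \<and>
     (\<forall>p. \<forall>i\<in>{1..s}. \<forall>j\<in>{1..s}. \<eta> i p (\<xi> j p) = (if i = j then 1 else 0)) \<and>
     (\<forall>p. \<forall>i\<in>{1..s}. f p (\<xi> i p) = 0) \<and>
     (\<forall>p. \<forall>i\<in>{1..s}. \<forall>v\<in>tangent_space A p. \<eta> i p (f p v) = 0) \<and>
     (\<forall>p. \<forall>v\<in>tangent_space A p. \<forall>w\<in>tangent_space A p.
        g p (f p v) (f p w) = g p v w - (\<Sum>i=1..s. \<eta> i p v * \<eta> i p w)) \<and>
     (\<forall>p. \<forall>i\<in>{1..s}. \<forall>v\<in>tangent_space A p. \<eta> i p v = g p v (\<xi> i p))"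

definition normal_f_structure ::
  "('a, 'm::finite) chart set \<Rightarrow> nat \<Rightarrow>
   ('a \<Rightarrow> ('a, 'm) tvec \<Rightarrow> ('a, 'm) tvec) \<Rightarrow> (nat \<Rightarrow> 'a \<Rightarrow> ('a, 'm) tvec) \<Rightarrow>
   (nat \<Rightarrow> 'a \<Rightarrow> ('a, 'm) tvec \<Rightarrow> real) \<Rightarrow> bool" where
  "normal_f_structure A s f \<xi> \<eta> \<longleftrightarrow>
     (\<forall>X Y. smooth_vector_field A X \<longrightarrow> smooth_vector_field A Y \<longrightarrow>
        (\<forall>p. nijenhuis A f X Y p + 2 *\<^sub>R (\<Sum>i=1..s. ext_deriv A (\<eta> i) X Y p *\<^sub>R \<xi> i p) = 0))"

definition trans_S_manifold ::
  "('a::{t2_space,second_countable_topology}, 'm::finite) chart set \<Rightarrow> nat \<Rightarrow> nat \<Rightarrow>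
   ('a \<Rightarrow> ('a, 'm) tvec \<Rightarrow> ('a, 'm) tvec) \<Rightarrow> (nat \<Rightarrow> 'a \<Rightarrow> ('a, 'm) tvec) \<Rightarrow>
   (nat \<Rightarrow> 'a \<Rightarrow> ('a, 'm) tvec \<Rightarrow> real) \<Rightarrow>
   ('a \<Rightarrow> ('a, 'm) tvec \<Rightarrow> ('a, 'm) tvec \<Rightarrow> real) \<Rightarrow>
   (nat \<Rightarrow> 'a \<Rightarrow> real) \<Rightarrow> (nat \<Rightarrow> 'a \<Rightarrow> real) \<Rightarrow> bool" where
  "trans_S_manifold A n s f \<xi> \<eta> g \<alpha> \<beta> \<longleftrightarrow>
     framed_metric_f_manifold A n s f \<xi> \<eta> g \<and> normal_f_structure A s f \<xi> \<eta> \<and>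
     (\<forall>i\<in>{1..s}. smooth_function A (\<alpha> i) \<and> smooth_function A (\<beta> i)) \<and>
     (\<forall>X Y. smooth_vector_field A X \<longrightarrow> smooth_vector_field A Y \<longrightarrow>
        (\<forall>p. levi_civita A g X (\<lambda>q. f q (Y q)) p - f p (levi_civita A g X Y p) =
           (\<Sum>i=1..s.
              \<alpha> i p *\<^sub>R (g p (f p (X p)) (f p (Y p)) *\<^sub>R \<xi> i p + \<eta> i p (Y p) *\<^sub>R f p (f p (X p)))
            + \<beta> i p *\<^sub>R (g p (f p (X p)) (Y p) *\<^sub>R \<xi> i p - \<eta> i p (Y p) *\<^sub>R f p (X p)))))"


section \<open>Curves\<close>

(* The parameter interval may be open or not, bounded or not; derivatives at an endpoint
   belonging to I are one-sided. *)

definition nondegenerate_interval :: "real set \<Rightarrow> bool"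
  where "nondegenerate_interval I \<longleftrightarrow> is_interval I \<and> (\<exists>a\<in>I. \<exists>b\<in>I. a < b)"

definition smooth_curve ::
  "('a::topological_space, 'm::finite) chart set \<Rightarrow> real set \<Rightarrow> (real \<Rightarrow> 'a) \<Rightarrow> bool" where
  "smooth_curve A I \<gamma> \<longleftrightarrow>
     nondegenerate_interval I \<and> continuous_on I \<gamma> \<and>
     (\<forall>c\<in>A. smooth_on {t\<in>I. \<gamma> t \<in> chart_dom c} (chart_map c \<circ> \<gamma>))"

definition velocity ::
  "('a, 'm::finite) chart set \<Rightarrow> real set \<Rightarrow> (real \<Rightarrow> 'a) \<Rightarrow> real \<Rightarrow> ('a, 'm) tvec" where
  "velocity A I \<gamma> t =
     (\<lambda>c. if c \<in> A \<and> \<gamma> t \<in> chart_dom c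
          then vector_derivative (chart_map c \<circ> \<gamma>) (at t within I) else 0)"

definition smooth_field_along ::
  "('a, 'm::finite) chart set \<Rightarrow> real set \<Rightarrow> (real \<Rightarrow> 'a) \<Rightarrow> (real \<Rightarrow> ('a, 'm) tvec) \<Rightarrow> bool" where
  "smooth_field_along A I \<gamma> V \<longleftrightarrow>
     (\<forall>t\<in>I. V t \<in> tangent_space A (\<gamma> t)) \<and>
     (\<forall>c\<in>A. smooth_on {t\<in>I. \<gamma> t \<in> chart_dom c} (\<lambda>t. V t c))"

(* The field V along the curve is differentiable and its covariant derivative in the
   direction of the velocity T is W: in every chart, W^k = (V^k)' + Gamma^k_ij T^i V^j. *)

definition has_cov_deriv_along ::
  "('a, 'm::finite) chart set \<Rightarrow> ('a \<Rightarrow> ('a, 'm) tvec \<Rightarrow> ('a, 'm) tvec \<Rightarrow> real) \<Rightarrow>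
   real set \<Rightarrow> (real \<Rightarrow> 'a) \<Rightarrow> (real \<Rightarrow> ('a, 'm) tvec) \<Rightarrow> (real \<Rightarrow> ('a, 'm) tvec) \<Rightarrow> bool" where
  "has_cov_deriv_along A g I \<gamma> V W \<longleftrightarrow>
     (\<forall>t\<in>I. V t \<in> tangent_space A (\<gamma> t) \<and> W t \<in> tangent_space A (\<gamma> t) \<and>
        (\<forall>c\<in>A. \<gamma> t \<in> chart_dom c \<longrightarrow>
           ((\<lambda>u. V u c) has_vector_derivative
              (W t c - connection_term A g c (\<gamma> t) (velocity A I \<gamma> t c) (V t c)))
             (at t within I)))"

definition has_normal_deriv_along ::
  "('a, 'm::finite) chart set \<Rightarrow> ('a \<Rightarrow> ('a, 'm) tvec \<Rightarrow> ('a, 'm) tvec \<Rightarrow> real) \<Rightarrow>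
   real set \<Rightarrow> (real \<Rightarrow> 'a) \<Rightarrow> (real \<Rightarrow> ('a, 'm) tvec) \<Rightarrow> (real \<Rightarrow> ('a, 'm) tvec) \<Rightarrow> bool" where
  "has_normal_deriv_along A g I \<gamma> V W \<longleftrightarrow>
     (\<exists>Z. has_cov_deriv_along A g I \<gamma> V Z \<and>
        (\<forall>t\<in>I. W t = Z t - g (\<gamma> t) (Z t) (velocity A I \<gamma> t) *\<^sub>R velocity A I \<gamma> t))"

(* The frame fields are E 1, ..., E r and the curvatures k 1, ..., k (r - 1). *)

definition frenet_curve ::
  "('a::topological_space, 'm::finite) chart set \<Rightarrow>
   ('a \<Rightarrow> ('a, 'm) tvec \<Rightarrow> ('a, 'm) tvec \<Rightarrow> real) \<Rightarrow> real set \<Rightarrow> (real \<Rightarrow> 'a) \<Rightarrow> nat \<Rightarrow>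
   (nat \<Rightarrow> real \<Rightarrow> ('a, 'm) tvec) \<Rightarrow> (nat \<Rightarrow> real \<Rightarrow> real) \<Rightarrow> bool" where
  "frenet_curve A g I \<gamma> r E \<kappa> \<longleftrightarrow>
     smooth_curve A I \<gamma> \<and> r \<ge> 1 \<and>
     (\<forall>t\<in>I. E 1 t = velocity A I \<gamma> t) \<and>
     (\<forall>j\<in>{1..r}. smooth_field_along A I \<gamma> (E j)) \<and>
     (\<forall>t\<in>I. \<forall>i\<in>{1..r}. \<forall>j\<in>{1..r}. g (\<gamma> t) (E i t) (E j t) = (if i = j then 1 else 0)) \<and>
     (\<forall>t\<in>I. \<forall>j\<in>{1..<r}. \<kappa> j t > 0) \<and>
     (\<forall>j\<in>{1..r}. has_cov_deriv_along A g I \<gamma> (E j)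
        (\<lambda>t. (if j = 1 then 0 else - \<kappa> (j - 1) t *\<^sub>R E (j - 1) t)
            + (if j = r then 0 else \<kappa> j t *\<^sub>R E (j + 1) t)))"

definition legendre_curve ::
  "('a, 'm::finite) chart set \<Rightarrow> nat \<Rightarrow> (nat \<Rightarrow> 'a \<Rightarrow> ('a, 'm) tvec \<Rightarrow> real) \<Rightarrow>
   real set \<Rightarrow> (real \<Rightarrow> 'a) \<Rightarrow> bool" where
  "legendre_curve A s \<eta> I \<gamma> \<longleftrightarrow> (\<forall>i\<in>{1..s}. \<forall>t\<in>I. \<eta> i (\<gamma> t) (velocity A I \<gamma> t) = 0)"

definition mean_curvature_along ::
  "('a, 'm::finite) chart set \<Rightarrow> ('a \<Rightarrow> ('a, 'm) tvec \<Rightarrow> ('a, 'm) tvec \<Rightarrow> real) \<Rightarrow>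
   real set \<Rightarrow> (real \<Rightarrow> 'a) \<Rightarrow> (real \<Rightarrow> ('a, 'm) tvec) \<Rightarrow> bool" where
  "mean_curvature_along A g I \<gamma> H \<longleftrightarrow> has_cov_deriv_along A g I \<gamma> (velocity A I \<gamma>) H"

definition C_parallel_normal ::
  "('a, 'm::finite) chart set \<Rightarrow> nat \<Rightarrow> (nat \<Rightarrow> 'a \<Rightarrow> ('a, 'm) tvec) \<Rightarrow>
   ('a \<Rightarrow> ('a, 'm) tvec \<Rightarrow> ('a, 'm) tvec \<Rightarrow> real) \<Rightarrow>
   real set \<Rightarrow> (real \<Rightarrow> 'a) \<Rightarrow> (real \<Rightarrow> real) \<Rightarrow> bool" where
  "C_parallel_normal A s \<xi> g I \<gamma> lam \<longleftrightarrow>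
     lam differentiable_on I \<and> (\<forall>t\<in>I. lam t \<noteq> 0) \<and>
     (\<exists>H. mean_curvature_along A g I \<gamma> H \<and>
          has_normal_deriv_along A g I \<gamma> H (\<lambda>t. lam t *\<^sub>R (\<Sum>i=1..s. \<xi> i (\<gamma> t))))"

end

theory Submission
  imports Defs
begin

text \<open>The curve satisfies \<open>\<nabla>\<^sub>T T = \<kappa> E\<^sub>2\<close> and \<open>\<nabla>\<^sub>T E\<^sub>2 = - \<kappa> T\<close>, so \<open>H = \<kappa> E\<^sub>2\<close> and \<open>\<nabla>\<^sup>\<bottom>\<^sub>T H = \<kappa>' E\<^sub>2\<close>.
  Differentiating \<open>g(T, \<xi>\<^sub>j) = 0\<close> and using the trans-S equation for \<open>\<nabla>\<^sub>T \<xi>\<^sub>j\<close> yields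
  \<open>\<kappa> g(E\<^sub>2, \<xi>\<^sub>j) + \<beta>\<^sub>j = 0\<close>. If \<open>\<kappa>' E\<^sub>2 = \<lambda> \<Sum> \<xi>\<^sub>i\<close>, then \<open>\<Sum> \<xi>\<^sub>i = h E\<^sub>2\<close> with \<open>h\<^sup>2 = s\<close>; since \<open>h\<close> is
  continuous on an interval it is constant, equal to \<open>\<sigma> \<surd>s\<close>, and everything follows from
  \<open>h g(E\<^sub>2, \<xi>\<^sub>j) = 1\<close>. Conversely \<open>\<kappa>' = \<sigma> \<surd>s \<lambda>\<close>, and \<open>\<lambda>\<close> is differentiable because
  \<open>\<lambda> = - \<beta>'\<close> with \<open>\<beta>\<close> smooth along the curve.

  The trans-S equation is stated for globally defined vector fields, whereas \<open>T\<close> lives on the curve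
  only; this is why tangent vectors have to be extended by means of bump functions.\<close>

section \<open>Calculus of smooth maps on open sets\<close>

text \<open>\<open>frechet_derivative\<close> is a choice among all derivatives, and functions that
  agree on \<open>S\<close> have the same set of derivatives at \<open>x\<close> within
  \<open>S\<close>. The two choices therefore coincide, even where the derivative is not
  unique.\<close>

lemma frechet_derivative_within_cong:
  assumes "x \<in> S" "\<And>y. y \<in> S \<Longrightarrow> f y = g y"
  shows "frechet_derivative f (at x within S) = frechet_derivative g (at x within S)"
proof -
  have "(f has_derivative D) (at x within S) \<longleftrightarrow> (g has_derivative D) (at x within S)" for D
    using assms has_derivative_transform by metis
  then show ?thesis by (simp add: frechet_derivative_def)
qed

lemma C_k_on_cong:
  assumes "\<And>x. x \<in> S \<Longrightarrow> h x = h' x"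
  shows "C_k_on k S h \<longleftrightarrow> C_k_on k S h'"
  using assms
proof (induction k arbitrary: h h')
  case 0
  then show ?case by (simp cong: continuous_on_cong)
next
  case (Suc k)
  have "h differentiable_on S \<longleftrightarrow> h' differentiable_on S"
    using Suc.prems unfolding differentiable_on_def differentiable_def
    by (metis has_derivative_transform)
  moreover have "C_k_on k S (\<lambda>x. frechet_derivative h (at x within S) v) \<longleftrightarrow>
      C_k_on k S (\<lambda>x. frechet_derivative h' (at x within S) v)" for v
    using Suc.prems by (intro Suc.IH) (metis frechet_derivative_within_cong)
  ultimately show ?case by simp
qed

text \<open>On an open set the derivative is unique, so the chosen \<open>frechet_derivative\<close>
  is the explicit \<open>D\<close>. The closure properties below are inductions on \<open>k\<close>
  in which \<open>D\<close> comes from the sum, product or chain rule.\<close>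

lemma C_k_on_SucI:
  assumes "open S" "\<And>x. x \<in> S \<Longrightarrow> (h has_derivative D x) (at x)"
    and "\<And>v. C_k_on k S (\<lambda>x. D x v)"
  shows "C_k_on (Suc k) S h"
proof -
  have "frechet_derivative h (at x within S) = D x" if "x \<in> S" for x
    using assms(1,2) that by (metis at_within_open frechet_derivative_at)
  then have "C_k_on k S (\<lambda>x. frechet_derivative h (at x within S) v)" for v
    using assms(3)[of v] by (simp cong: C_k_on_cong)
  moreover have "h differentiable_on S"
    using assms(2) by (meson differentiable_def differentiable_at_withinI differentiable_on_def)
  ultimately show ?thesis by simp
qed

lemma C_k_on_SucD:
  assumes "open S" "C_k_on (Suc k) S h"
  shows "\<And>x. x \<in> S \<Longrightarrow> (h has_derivative frechet_derivative h (at x)) (at x)"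
    and "C_k_on k S (\<lambda>x. frechet_derivative h (at x) v)"
proof -
  show "(h has_derivative frechet_derivative h (at x)) (at x)" if "x \<in> S" for x
  proof -
    have "h differentiable (at x within S)"
      using assms that by (simp add: differentiable_on_def)
    then have "h differentiable at x"
      using at_within_open[OF that assms(1)] by simp
    then show ?thesis by (simp add: frechet_derivative_works)
  qed
  have "C_k_on k S (\<lambda>x. frechet_derivative h (at x within S) v)"
    using assms by simp
  then show "C_k_on k S (\<lambda>x. frechet_derivative h (at x) v)"
    by (rule C_k_on_cong[THEN iffD1, rotated]) (simp add: at_within_open[OF _ assms(1)])
qed

lemma C_k_on_Suc_imp: "C_k_on (Suc k) S h \<Longrightarrow> C_k_on k S h"
  by (induction k arbitrary: h) (auto simp: differentiable_imp_continuous_on)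

text \<open>Used for the cut-off vector field further down, which is given by different formulas on
  different open pieces of a chart image. On open sets the derivative at a point does not refer to
  the set, so the induction passes from the pieces to \<open>S\<close>.\<close>

lemma C_k_on_local:
  assumes "\<And>x. x \<in> S \<Longrightarrow> \<exists>U. open U \<and> x \<in> U \<and> U \<subseteq> S \<and> C_k_on k U h"
  shows "C_k_on k S h"
proof -
  have S: "open S"
    using assms by (subst open_subopen) blast
  show ?thesis
    using assms
  proof (induction k arbitrary: h)
    case 0
    have "isCont h x" if "x \<in> S" for x
      using 0[OF that] continuous_on_eq_continuous_at by auto
    then show ?case by (simp add: continuous_at_imp_continuous_on)
  next
    case (Suc k)
    show ?case
    proof (rule C_k_on_SucI[OF S, where D = "\<lambda>x. frechet_derivative h (at x)"])
      show "(h has_derivative frechet_derivative h (at x)) (at x)" if "x \<in> S" for x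
        using Suc.prems[OF that] C_k_on_SucD(1) by blast
      show "C_k_on k S (\<lambda>x. frechet_derivative h (at x) v)" for v
      proof (rule Suc.IH)
        fix x assume "x \<in> S"
        then obtain U where "open U" "x \<in> U" "U \<subseteq> S" "C_k_on (Suc k) U h"
          using Suc.prems by blast
        then show "\<exists>U. open U \<and> x \<in> U \<and> U \<subseteq> S \<and> C_k_on k U (\<lambda>x. frechet_derivative h (at x) v)"
          by (intro exI[of _ U] conjI C_k_on_SucD(2))
      qed
    qed
  qed
qed

lemma C_k_on_const: "open S \<Longrightarrow> C_k_on k S (\<lambda>x. a)"
proof (induction k arbitrary: a)
  case (Suc k)
  then show ?case
    by (intro C_k_on_SucI[where D = "\<lambda>x v. 0"]) auto
qed auto

lemma C_k_on_bounded_linear: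
  assumes "bounded_linear L" "open S" "C_k_on k S h"
  shows "C_k_on k S (\<lambda>x. L (h x))"
  using assms(3)
proof (induction k arbitrary: h)
  case 0
  then show ?case using assms(1) by (auto intro: bounded_linear.continuous_on)
next
  case (Suc k)
  note D = C_k_on_SucD[OF assms(2) Suc.prems]
  show ?case
    by (intro C_k_on_SucI[where D = "\<lambda>x v. L (frechet_derivative h (at x) v)"] assms(2)
        bounded_linear.has_derivative[OF assms(1)] D(1) Suc.IH D(2))
qed

lemma C_k_on_id: "open S \<Longrightarrow> C_k_on k S (\<lambda>x. x)"
proof (induction k)
  case (Suc k)
  then show ?case
    by (intro C_k_on_SucI[where D = "\<lambda>x v. v"]) (auto intro: C_k_on_const)
qed auto

lemma C_k_on_add:
  assumes "open S" "C_k_on k S h" "C_k_on k S h'"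
  shows "C_k_on k S (\<lambda>x. h x + h' x)"
  using assms(2,3)
proof (induction k arbitrary: h h')
  case 0
  then show ?case by (auto intro: continuous_on_add)
next
  case (Suc k)
  note D = C_k_on_SucD[OF assms(1) Suc.prems(1)] C_k_on_SucD[OF assms(1) Suc.prems(2)]
  show ?case
    by (intro C_k_on_SucI[where D = "\<lambda>x v. frechet_derivative h (at x) v + frechet_derivative h' (at x) v"]
        assms(1) has_derivative_add D Suc.IH)
qed

lemma C_k_on_sum:
  assumes "open S" "finite B" "\<And>i. i \<in> B \<Longrightarrow> C_k_on k S (h i)"
  shows "C_k_on k S (\<lambda>x. \<Sum>i\<in>B. h i x)"
  using assms(2,3)
  by (induction B rule: finite_induct) (auto intro: C_k_on_const C_k_on_add assms(1))

lemma C_k_on_scaleR: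
  fixes h :: "'a::euclidean_space \<Rightarrow> real"
  assumes "open S" "C_k_on k S h" "C_k_on k S h'"
  shows "C_k_on k S (\<lambda>x. h x *\<^sub>R h' x)"
  using assms(2,3)
proof (induction k arbitrary: h h')
  case 0
  then show ?case by (auto intro: continuous_on_scaleR)
next
  case (Suc k)
  note D = C_k_on_SucD[OF assms(1) Suc.prems(1)] C_k_on_SucD[OF assms(1) Suc.prems(2)]
  show ?case
    by (intro C_k_on_SucI[where D = "\<lambda>x v. h x *\<^sub>R frechet_derivative h' (at x) v
          + frechet_derivative h (at x) v *\<^sub>R h' x"]
        assms(1) has_derivative_scaleR D Suc.IH C_k_on_add Suc.prems[THEN C_k_on_Suc_imp])
qed

lemma C_k_on_compose:
  fixes h :: "'b::euclidean_space \<Rightarrow> 'c::real_normed_vector" and u :: "'a::euclidean_space \<Rightarrow> 'b"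
  assumes "open S" "open U" "u ` S \<subseteq> U" "C_k_on k U h" "C_k_on k S u"
  shows "C_k_on k S (\<lambda>x. h (u x))"
  using assms(4,5)
proof (induction k arbitrary: h)
  case 0
  then show ?case using assms(3) continuous_on_compose2 by auto
next
  case (Suc k)
  note Dh = C_k_on_SucD[OF assms(2) Suc.prems(1)] and Du = C_k_on_SucD[OF assms(1) Suc.prems(2)]
  let ?D = "\<lambda>x v. frechet_derivative h (at (u x)) (frechet_derivative u (at x) v)"
  show ?case
  proof (rule C_k_on_SucI[OF assms(1), where D = ?D])
    show "((\<lambda>x. h (u x)) has_derivative ?D x) (at x)" if "x \<in> S" for x
      using has_derivative_compose[OF Du(1)[OF that], of h] Dh(1)[of "u x"] that assms(3) by blast
    fix v
    \<comment> \<open>In the chain rule the direction fed to the derivative of \<open>h\<close>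
      varies with \<open>x\<close>. Expanding it in the standard basis leaves derivatives in fixed
      directions, multiplied by scalar functions, to which the induction hypothesis and the product
      lemma apply.\<close>
    have "?D x v = (\<Sum>b\<in>Basis. (frechet_derivative u (at x) v \<bullet> b) *\<^sub>R
        frechet_derivative h (at (u x)) b)" if "x \<in> S" for x
    proof -
      have "linear (frechet_derivative h (at (u x)))"
        using Dh(1)[of "u x"] that assms(3) has_derivative_linear by blast
      then show ?thesis
        by (subst euclidean_representation[of "frechet_derivative u (at x) v", symmetric])
          (simp only: linear_sum linear_scale o_def)
    qed
    moreover have "C_k_on k S (\<lambda>x. \<Sum>b\<in>Basis. (frechet_derivative u (at x) v \<bullet> b) *\<^sub>R
        frechet_derivative h (at (u x)) b)"
      by (intro C_k_on_sum C_k_on_scaleR assms(1) finite_Basis Suc.IH[OF Dh(2)] C_k_on_Suc_imp[OF Suc.prems(2)]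
          C_k_on_bounded_linear[OF bounded_linear_inner_left] Du(2))
    ultimately show "C_k_on k S (\<lambda>x. ?D x v)"
      by (simp cong: C_k_on_cong)
  qed
qed

lemma smooth_on_has_derivative:
  assumes "open S" "smooth_on S h" "x \<in> S"
  shows "(h has_derivative frechet_derivative h (at x)) (at x)"
  using C_k_on_SucD(1)[OF assms(1) _ assms(3)] assms(2) unfolding smooth_on_def by blast

lemma smooth_on_frechet_derivative:
  assumes "open S" "smooth_on S h"
  shows "smooth_on S (\<lambda>x. frechet_derivative h (at x) v)"
  using C_k_on_SucD(2)[OF assms(1)] assms(2) unfolding smooth_on_def by blast

section \<open>Bump functions\<close>

text \<open>The function x^(-n) e^(-1/x), extended by 0 to x <= 0. All exponents are treated
  together because the family is closed under differentiation up to linear combinations, which makes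
  smoothness an induction over all \<open>n\<close> at once.\<close>

definition flat :: "nat \<Rightarrow> real \<Rightarrow> real"
  where "flat n x = (if x > 0 then inverse x ^ n / exp (inverse x) else 0)"

lemma flat_tendsto_0: "(flat n \<longlongrightarrow> 0) (at 0)"
proof (rule filterlim_split_at)
  have "eventually (\<lambda>x. x < (0::real)) (at_left 0)"
    by (simp add: eventually_at_left_field) (meson lt_ex)
  then show "(flat n \<longlongrightarrow> 0) (at_left 0)"
    by (intro tendsto_eventually) (auto simp: flat_def elim: eventually_mono)
  have "((\<lambda>x. inverse x ^ n / exp (inverse x)) \<longlongrightarrow> 0) (at_right (0::real))"
    by (rule filterlim_compose[OF tendsto_power_div_exp_0 filterlim_inverse_at_top_right])
  moreover have "eventually (\<lambda>x. flat n x = inverse x ^ n / exp (inverse x)) (at_right 0)"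
    by (auto simp: flat_def eventually_at_right_field intro: exI[of _ 1])
  ultimately show "(flat n \<longlongrightarrow> 0) (at_right 0)"
    using tendsto_cong by fastforce
qed

lemma flat_has_derivative:
  "(flat n has_real_derivative flat (n + 2) x - n * flat (n + 1) x) (at x)"
proof (cases x "0::real" rule: linorder_cases)
  case less
  have "((\<lambda>x. 0) has_real_derivative 0) (at x)" by simp
  then have "(flat n has_real_derivative 0) (at x)"
    by (rule has_field_derivative_transform_within_open[where S = "{..<0}"])
      (use less in \<open>auto simp: flat_def\<close>)
  then show ?thesis using less by (simp add: flat_def)
next
  case equal
  \<comment> \<open>The difference quotient of \<open>flat n\<close> at 0 is again a member of the
    family, so its limit is already known.\<close>
  have "eventually (\<lambda>h. flat (n + 1) h = (flat n (0 + h) - flat n 0) / h) (at 0)"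
    by (auto simp: eventually_at_filter flat_def divide_simps)
  then have "((\<lambda>h. (flat n (0 + h) - flat n 0) / h) \<longlongrightarrow> 0) (at 0)"
    using flat_tendsto_0[of "n + 1"] tendsto_cong by fast
  then show ?thesis using equal by (simp add: DERIV_def flat_def)
next
  case greater
  have "((\<lambda>x. inverse x ^ n * exp (- inverse x)) has_real_derivative
      inverse x ^ n * (exp (- inverse x) * (inverse x * inverse x))
      - n * (inverse x ^ (n - 1) * (inverse x * inverse x)) * exp (- inverse x)) (at x)"
    using greater by (auto intro!: derivative_eq_intros simp: algebra_simps)
  also have "inverse x ^ n * (exp (- inverse x) * (inverse x * inverse x))
      - n * (inverse x ^ (n - 1) * (inverse x * inverse x)) * exp (- inverse x)
      = flat (n + 2) x - n * flat (n + 1) x"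
    using greater by (cases n) (auto simp: flat_def exp_minus divide_inverse mult_ac)
  finally have "((\<lambda>x. inverse x ^ n / exp (inverse x)) has_real_derivative
      flat (n + 2) x - n * flat (n + 1) x) (at x)"
    by (simp add: exp_minus divide_inverse)
  then show ?thesis
    by (rule has_field_derivative_transform_within_open[where S = "{0<..}"])
      (use greater in \<open>auto simp: flat_def\<close>)
qed

lemma C_k_on_flat: "C_k_on k UNIV (flat n)"
proof (induction k arbitrary: n)
  case 0
  then show ?case
    using flat_has_derivative DERIV_isCont by (force simp: continuous_on_eq_continuous_at)
next
  case (Suc k)
  have "C_k_on k UNIV (\<lambda>x. v *\<^sub>R (flat (n + 2) x + (- n) *\<^sub>R flat (n + 1) x))" for v
    by (intro C_k_on_bounded_linear[OF bounded_linear_scaleR_right] C_k_on_add Suc.IH open_UNIV)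
  then show ?case
    by (intro C_k_on_SucI[where D = "\<lambda>x v. v *\<^sub>R (flat (n + 2) x + (- n) *\<^sub>R flat (n + 1) x)"])
      (use flat_has_derivative[of n] in \<open>auto simp: has_field_derivative_def mult.commute[of _ "_ - _"]\<close>)
qed

lemma smooth_bump_exists:
  fixes a :: "'a::euclidean_space"
  assumes "r > 0"
  obtains \<phi> :: "'a \<Rightarrow> real"
  where "smooth_on UNIV \<phi>" "\<phi> a = 1" "\<And>x. x \<notin> cball a r \<Longrightarrow> \<phi> x = 0"
proof
  \<comment> \<open>This is r^2 - |x - a|^2, positive exactly inside the ball; \<open>flat 0\<close>
    of it is therefore supported in the ball. It is spelled out in coordinates so that smoothness
    follows from the closure lemmas, and the final factor normalises the value at \<open>a\<close>
    to 1.\<close>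
  define q where "q x = r\<^sup>2 + (- 1) *\<^sub>R (\<Sum>b\<in>Basis. ((x - a) \<bullet> b) *\<^sub>R ((x - a) \<bullet> b))" for x
  have q: "q x = r\<^sup>2 - (dist a x)\<^sup>2" for x
    by (simp add: q_def dist_norm norm_minus_commute[of a] power2_norm_eq_inner
        euclidean_inner[of "x - a" "x - a"])
  have "C_k_on k UNIV (\<lambda>x. (x - a) \<bullet> b)" for k b
  proof -
    have "C_k_on k UNIV (\<lambda>x. (x + (- a)) \<bullet> b)"
      by (intro C_k_on_bounded_linear[OF bounded_linear_inner_left] C_k_on_add C_k_on_id C_k_on_const open_UNIV)
    then show ?thesis by simp
  qed
  then have "C_k_on k UNIV q" for k
    unfolding q_def
    by (intro C_k_on_add C_k_on_const C_k_on_bounded_linear[OF bounded_linear_scaleR_right] C_k_on_sum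
        C_k_on_scaleR open_UNIV finite_Basis)
  then show "smooth_on UNIV (\<lambda>x. (1 / flat 0 (r\<^sup>2)) *\<^sub>R flat 0 (q x))"
    unfolding smooth_on_def
    by (intro allI C_k_on_bounded_linear[OF bounded_linear_scaleR_right] C_k_on_compose[OF _ _ _ C_k_on_flat]) auto
  show "(1 / flat 0 (r\<^sup>2)) *\<^sub>R flat 0 (q a) = 1"
    using assms by (simp add: q flat_def)
  show "(1 / flat 0 (r\<^sup>2)) *\<^sub>R flat 0 (q x) = 0" if "x \<notin> cball a r" for x
  proof -
    have "r < dist a x" using that by simp
    then have "r\<^sup>2 < (dist a x)\<^sup>2" using assms by (intro power_strict_mono) auto
    then show ?thesis by (simp add: q flat_def)
  qed
qed


section \<open>Charts and tangent vectors\<close>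

lemma fun_sum_apply: "(\<Sum>i\<in>B. v i) c = (\<Sum>i\<in>B. v i c)" for v :: "'i \<Rightarrow> 'x \<Rightarrow> 'y::comm_monoid_add"
  by (induction B rule: infinite_finite_induct) auto

lemma fun_scaleR_apply [simp]: "(r *\<^sub>R v) c = r *\<^sub>R v c" for v :: "'x \<Rightarrow> 'y::real_vector"
  by (simp add: scaleR_fun_def)

locale manifold =
  fixes A :: "('a::{t2_space,second_countable_topology}, 'm::finite) chart set"
  assumes smooth_manifold: "smooth_manifold A"
begin

abbreviation jac :: "('a, 'm) chart \<Rightarrow> ('a, 'm) chart \<Rightarrow> 'a \<Rightarrow> real^'m \<Rightarrow> real^'m"
  where "jac c d p \<equiv> frechet_derivative (transition c d) (at (chart_map c p))"

lemma chart_exists: "\<exists>c\<in>A. p \<in> chart_dom c"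
  using smooth_manifold unfolding smooth_manifold_def by blast

lemma chart_at: "chart_at A p \<in> A" "p \<in> chart_dom (chart_at A p)"
  using someI_ex[of "\<lambda>c. c \<in> A \<and> p \<in> chart_dom c"] chart_exists[of p] unfolding chart_at_def by blast+

lemma
  assumes "c \<in> A"
  shows open_chart_dom: "open (chart_dom c)" and open_chart_img: "open (chart_img c)"
    and chart_homeomorphism: "homeomorphism (chart_dom c) (chart_img c) (chart_map c) (chart_inv c)"
  using smooth_manifold assms unfolding smooth_manifold_def by blast+

lemma chart_inv_map [simp]: "c \<in> A \<Longrightarrow> p \<in> chart_dom c \<Longrightarrow> chart_inv c (chart_map c p) = p"
  using homeomorphism_apply1[OF chart_homeomorphism] .

lemma chart_map_inv [simp]: "c \<in> A \<Longrightarrow> x \<in> chart_img c \<Longrightarrow> chart_map c (chart_inv c x) = x"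
  using homeomorphism_apply2[OF chart_homeomorphism] .

lemma chart_inv_in [simp]: "c \<in> A \<Longrightarrow> x \<in> chart_img c \<Longrightarrow> chart_inv c x \<in> chart_dom c"
  by auto

lemma continuous_on_chart_inv: "c \<in> A \<Longrightarrow> continuous_on (chart_img c) (chart_inv c)"
  using chart_homeomorphism homeomorphism_def by blast

lemma open_chart_image:
  assumes "c \<in> A" "open U" "U \<subseteq> chart_dom c"
  shows "open (chart_map c ` U)"
proof -
  have "openin (top_of_set (chart_img c)) (chart_map c ` U)"
    using assms by (intro homeomorphism_imp_open_map[OF chart_homeomorphism] open_openin_trans open_chart_dom)
  then show ?thesis using open_chart_img[OF assms(1)] by (simp add: openin_open_eq)
qed

lemma smooth_on_transition:
  assumes "c \<in> A" "d \<in> A"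
  shows "smooth_on (chart_map c ` (chart_dom c \<inter> chart_dom d)) (transition c d)"
  using smooth_manifold assms unfolding smooth_manifold_def by blast

lemma open_overlap: "c \<in> A \<Longrightarrow> d \<in> A \<Longrightarrow> open (chart_map c ` (chart_dom c \<inter> chart_dom d))"
  by (intro open_chart_image) (auto simp: open_chart_dom)

lemma transition_has_derivative:
  assumes "c \<in> A" "d \<in> A" "p \<in> chart_dom c" "p \<in> chart_dom d"
  shows "(transition c d has_derivative jac c d p) (at (chart_map c p))"
  using assms by (intro smooth_on_has_derivative[OF open_overlap smooth_on_transition]) auto

lemma linear_jac:
  assumes "c \<in> A" "d \<in> A" "p \<in> chart_dom c" "p \<in> chart_dom d"
  shows "linear (jac c d p)"
  using transition_has_derivative[OF assms] has_derivative_linear by blast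

text \<open>Chain rule on the image of the triple overlap, where the transition maps compose. This
  cocycle identity is what makes \<open>of_coords\<close> produce a tangent vector.\<close>

lemma jac_trans:
  assumes "c \<in> A" "d \<in> A" "e \<in> A" "p \<in> chart_dom c" "p \<in> chart_dom d" "p \<in> chart_dom e"
  shows "jac d e p (jac c d p x) = jac c e p x"
proof -
  have p: "transition c d (chart_map c p) = chart_map d p"
    using assms by (simp add: transition_def)
  have "((\<lambda>x. transition d e (transition c d x)) has_derivative (\<lambda>x. jac d e p (jac c d p x)))
      (at (chart_map c p))"
    using assms by (intro has_derivative_compose[OF transition_has_derivative])
      (auto simp: p intro: transition_has_derivative)
  moreover have "open (chart_map c ` (chart_dom c \<inter> chart_dom d \<inter> chart_dom e))"
    using assms by (intro open_chart_image open_Int open_chart_dom) auto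
  ultimately have "(transition c e has_derivative (\<lambda>x. jac d e p (jac c d p x))) (at (chart_map c p))"
    by (rule has_derivative_transform_within_open) (use assms in \<open>auto simp: transition_def\<close>)
  then show ?thesis
    using has_derivative_unique[OF _ transition_has_derivative[of c e p]] assms by metis
qed

lemma jac_self:
  assumes "c \<in> A" "p \<in> chart_dom c"
  shows "jac c c p x = x"
proof -
  have "((\<lambda>x. x) has_derivative (\<lambda>x. x)) (at (chart_map c p))" by simp
  then have "(transition c c has_derivative (\<lambda>x. x)) (at (chart_map c p))"
    by (rule has_derivative_transform_within_open[OF _ open_chart_img[OF assms(1)]])
      (use assms in \<open>auto simp: transition_def\<close>)
  then show ?thesis
    using has_derivative_unique[OF _ transition_has_derivative[of c c p]] assms by metis
qed

section \<open>Tangent vectors through their coordinates in one chart\<close>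

lemma of_coords_self: "c \<in> A \<Longrightarrow> p \<in> chart_dom c \<Longrightarrow> of_coords A c p x c = x"
  by (simp add: of_coords_def jac_self)

lemma of_coords_tangent:
  assumes "c \<in> A" "p \<in> chart_dom c"
  shows "of_coords A c p x \<in> tangent_space A p"
  using assms by (auto simp: tangent_space_def of_coords_def jac_trans)

lemma tangent_eq_of_coords:
  assumes "c \<in> A" "p \<in> chart_dom c" "v \<in> tangent_space A p"
  shows "v = of_coords A c p (v c)"
proof
  fix d
  have "v d = jac c d p (v c)" if "d \<in> A \<and> p \<in> chart_dom d"
    using assms that unfolding tangent_space_def by blast
  moreover have "v d = 0" if "\<not> (d \<in> A \<and> p \<in> chart_dom d)"
    using assms(3) that unfolding tangent_space_def by blast
  ultimately show "v d = of_coords A c p (v c) d"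
    unfolding of_coords_def by presburger
qed

lemma tangent_eqI:
  assumes "v \<in> tangent_space A p" "w \<in> tangent_space A p"
    and "c \<in> A" "p \<in> chart_dom c" "v c = w c"
  shows "v = w"
  using tangent_eq_of_coords[OF assms(3,4,1)] tangent_eq_of_coords[OF assms(3,4,2)] assms(5) by argo

lemma of_coords_add:
  assumes "c \<in> A" "p \<in> chart_dom c"
  shows "of_coords A c p (x + y) = of_coords A c p x + of_coords A c p y"
  using linear_add[OF linear_jac] assms by (fastforce simp: of_coords_def)

lemma of_coords_scaleR:
  assumes "c \<in> A" "p \<in> chart_dom c"
  shows "of_coords A c p (r *\<^sub>R x) = r *\<^sub>R of_coords A c p x"
  using linear_scale[OF linear_jac] assms by (fastforce simp: of_coords_def)

lemma of_coords_0:
  assumes "c \<in> A" "p \<in> chart_dom c"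
  shows "of_coords A c p 0 = 0"
  using of_coords_scaleR[OF assms, of 0 0] by simp

lemma tangent_zero [simp]: "0 \<in> tangent_space A p"
  using chart_exists of_coords_0 of_coords_tangent by metis

lemma tangent_add [simp]:
  assumes "v \<in> tangent_space A p" "w \<in> tangent_space A p"
  shows "v + w \<in> tangent_space A p"
proof -
  obtain c where c: "c \<in> A" "p \<in> chart_dom c" using chart_exists by blast
  have "of_coords A c p (v c + w c) = v + w"
    using of_coords_add[OF c] tangent_eq_of_coords[OF c] assms by simp
  then show ?thesis using of_coords_tangent[OF c] by metis
qed

lemma tangent_scaleR [simp]:
  assumes "v \<in> tangent_space A p"
  shows "r *\<^sub>R v \<in> tangent_space A p"
proof -
  obtain c where c: "c \<in> A" "p \<in> chart_dom c" using chart_exists by blast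
  have "of_coords A c p (r *\<^sub>R v c) = r *\<^sub>R v"
    using of_coords_scaleR[OF c] tangent_eq_of_coords[OF c] assms by simp
  then show ?thesis using of_coords_tangent[OF c] by metis
qed

lemma tangent_sum: "(\<And>i. i \<in> B \<Longrightarrow> v i \<in> tangent_space A p) \<Longrightarrow> (\<Sum>i\<in>B. v i) \<in> tangent_space A p"
  by (induction B rule: infinite_finite_induct) (simp_all add: tangent_add)

lemma tangent_coord_vec: "c \<in> A \<Longrightarrow> p \<in> chart_dom c \<Longrightarrow> coord_vec A c i p \<in> tangent_space A p"
  by (simp add: coord_vec_def of_coords_tangent)

lemma tangent_expansion:
  assumes "c \<in> A" "p \<in> chart_dom c" "v \<in> tangent_space A p"
  shows "v = (\<Sum>i\<in>UNIV. v c $ i *\<^sub>R coord_vec A c i p)"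
proof (rule tangent_eqI[OF assms(3) _ assms(1,2)])
  show "(\<Sum>i\<in>UNIV. v c $ i *\<^sub>R coord_vec A c i p) \<in> tangent_space A p"
    using assms by (intro tangent_sum tangent_scaleR tangent_coord_vec)
  show "v c = (\<Sum>i\<in>UNIV. v c $ i *\<^sub>R coord_vec A c i p) c"
    using assms basis_expansion[of "v c"]
    by (simp add: fun_sum_apply coord_vec_def of_coords_self scalar_mult_eq_scaleR)
qed

text \<open>Give the field constant coordinates in a chart around \<open>p\<close>, multiply by a
  bump function supported in a closed ball of the chart image, and extend by 0. This carries the
  trans-S equation, stated for global fields, over to single tangent vectors.\<close>

lemma smooth_vector_field_extension:
  assumes v: "v \<in> tangent_space A p"
  obtains X where "smooth_vector_field A X" "X p = v"
proof -
  obtain c where c: "c \<in> A" "p \<in> chart_dom c" using chart_exists by blast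
  obtain r where r: "r > 0" "cball (chart_map c p) r \<subseteq> chart_img c"
    using open_contains_cball open_chart_img[OF c(1)] c(2) by blast
  obtain \<phi> :: "real^'m \<Rightarrow> real" where \<phi>: "smooth_on UNIV \<phi>" "\<phi> (chart_map c p) = 1"
    "\<And>x. x \<notin> cball (chart_map c p) r \<Longrightarrow> \<phi> x = 0"
    using smooth_bump_exists[OF r(1)] by blast
  \<comment> \<open>\<open>K\<close> is the compact preimage of the ball. By the Hausdorff property
    it is closed in the whole manifold, and not just in the chart domain, so that \<open>X\<close>
    vanishes on an open neighbourhood of each point outside \<open>K\<close>.\<close>
  define K where "K = chart_inv c ` cball (chart_map c p) r"
  have K: "closed K"
    unfolding K_def
    by (intro compact_imp_closed compact_continuous_image compact_cball
        continuous_on_subset[OF continuous_on_chart_inv[OF c(1)] r(2)])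
  define X where "X q = (if q \<in> chart_dom c then \<phi> (chart_map c q) *\<^sub>R of_coords A c q (v c) else 0)" for q
  have tangent: "X q \<in> tangent_space A q" for q
    by (simp add: X_def of_coords_tangent c(1))
  have X0: "X q = 0" if "q \<notin> K" for q
  proof (cases "q \<in> chart_dom c")
    case True
    then have "chart_map c q \<notin> cball (chart_map c p) r"
      using that c(1) unfolding K_def by (metis chart_inv_map imageI)
    then show ?thesis by (simp add: X_def \<phi>(3))
  qed (simp add: X_def)
  have "C_k_on k (chart_img d) ((\<lambda>q. X q d) \<circ> chart_inv d)" if d: "d \<in> A" for d k
  proof (rule C_k_on_local)
    fix x assume x: "x \<in> chart_img d"
    show "\<exists>U. open U \<and> x \<in> U \<and> U \<subseteq> chart_img d \<and> C_k_on k U ((\<lambda>q. X q d) \<circ> chart_inv d)"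
    proof (cases "chart_inv d x \<in> K")
      case False
      define U where "U = chart_map d ` (chart_dom d - K)"
      have U: "open U"
        unfolding U_def using d K by (intro open_chart_image) (auto simp: open_chart_dom)
      have "((\<lambda>q. X q d) \<circ> chart_inv d) y = 0" if "y \<in> U" for y
        using that d X0 by (auto simp: U_def)
      then have "C_k_on k U ((\<lambda>q. X q d) \<circ> chart_inv d)"
        using C_k_on_cong[of U _ "\<lambda>y. 0"] C_k_on_const[OF U] by blast
      moreover have "x \<in> U"
        unfolding U_def using x d False by (intro image_eqI[of _ _ "chart_inv d x"]) auto
      ultimately show ?thesis using U unfolding U_def by blast
    next
      case True
      \<comment> \<open>On the overlap the coordinates of \<open>X\<close> in the chart
        \<open>d\<close> are the bump function times the Jacobian from \<open>c\<close> to
        \<open>d\<close> applied to the constant vector \<open>v c\<close>, both pulled back along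
        the transition map.\<close>
      define U where "U = chart_map d ` (chart_dom d \<inter> chart_dom c)"
      let ?V = "chart_map c ` (chart_dom c \<inter> chart_dom d)"
      have U: "open U" and V: "open ?V"
        unfolding U_def using d c open_overlap by blast+
      have UV: "transition d c ` U \<subseteq> ?V"
        using d by (auto simp: U_def transition_def)
      have trans: "C_k_on k U (transition d c)"
        using smooth_on_transition[OF d c(1)] by (simp add: U_def smooth_on_def)
      have "((\<lambda>q. X q d) \<circ> chart_inv d) y = \<phi> (transition d c y) *\<^sub>R
          frechet_derivative (transition c d) (at (transition d c y)) (v c)" if "y \<in> U" for y
        using that d by (auto simp: U_def X_def transition_def of_coords_def)
      moreover have "C_k_on k U (\<lambda>y. \<phi> (transition d c y) *\<^sub>R
          frechet_derivative (transition c d) (at (transition d c y)) (v c))"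
      proof (intro C_k_on_scaleR[OF U])
        show "C_k_on k U (\<lambda>y. \<phi> (transition d c y))"
          using \<phi>(1) by (intro C_k_on_compose[OF U open_UNIV _ _ trans]) (auto simp: smooth_on_def)
        have "smooth_on ?V (\<lambda>x. frechet_derivative (transition c d) (at x) (v c))"
          by (intro smooth_on_frechet_derivative[OF V] smooth_on_transition c d)
        then show "C_k_on k U (\<lambda>y. frechet_derivative (transition c d) (at (transition d c y)) (v c))"
          by (intro C_k_on_compose[OF U V UV _ trans]) (simp add: smooth_on_def)
      qed
      ultimately have "C_k_on k U ((\<lambda>q. X q d) \<circ> chart_inv d)"
        by (rule C_k_on_cong[THEN iffD2])
      moreover have "chart_inv d x \<in> chart_dom c"
        using True r(2) c(1) unfolding K_def by auto
      then have "x \<in> U"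
        unfolding U_def using x d by (intro image_eqI[of _ _ "chart_inv d x"]) auto
      ultimately show ?thesis using U unfolding U_def by blast
    qed
  qed
  then have "smooth_vector_field A X"
    using tangent by (simp add: smooth_vector_field_def smooth_on_def)
  moreover have "X p = v"
    using tangent_eq_of_coords[OF c v] c \<phi>(2) by (simp add: X_def)
  ultimately show ?thesis using that by blast
qed

end


section \<open>The Levi-Civita connection and the metric\<close>

locale riemannian = manifold A
  for A :: "('a::{t2_space,second_countable_topology}, 'm::finite) chart set" +
  fixes g :: "'a \<Rightarrow> ('a, 'm) tvec \<Rightarrow> ('a, 'm) tvec \<Rightarrow> real"
  assumes metric: "riemannian_metric A g"
begin

abbreviation T :: "'a \<Rightarrow> ('a, 'm) tvec set"
  where "T \<equiv> tangent_space A"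

lemma
  assumes "v \<in> T p" "w \<in> T p"
  shows g_sym: "g p v w = g p w v"
    and g_scale_right [simp]: "g p v (r *\<^sub>R w) = r * g p v w"
    and g_pos: "v \<noteq> 0 \<Longrightarrow> g p v v > 0"
  using metric assms unfolding riemannian_metric_def linear_on_space_def by fastforce+

lemma g_add_right [simp]: "v \<in> T p \<Longrightarrow> w \<in> T p \<Longrightarrow> w' \<in> T p \<Longrightarrow> g p v (w + w') = g p v w + g p v w'"
  using metric unfolding riemannian_metric_def linear_on_space_def by blast

lemma g_add_left [simp]: "v \<in> T p \<Longrightarrow> w \<in> T p \<Longrightarrow> w' \<in> T p \<Longrightarrow> g p (w + w') v = g p w v + g p w' v"
  by (simp add: g_sym[of _ p v])

lemma g_scale_left [simp]: "v \<in> T p \<Longrightarrow> w \<in> T p \<Longrightarrow> g p (r *\<^sub>R w) v = r * g p w v"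
  by (simp add: g_sym[of _ p v])

lemma g_zero_right [simp]: "v \<in> T p \<Longrightarrow> g p v 0 = 0"
  using g_scale_right[of v p 0 0] by simp

lemma g_zero_left [simp]: "v \<in> T p \<Longrightarrow> g p 0 v = 0"
  using g_sym[of v p 0] by simp

lemma g_minus_right [simp]: "v \<in> T p \<Longrightarrow> w \<in> T p \<Longrightarrow> g p v (- w) = - g p v w"
  using g_scale_right[of v p w "- 1"] by simp

lemma g_sum_right:
  assumes "v \<in> T p" "\<And>i. i \<in> B \<Longrightarrow> w i \<in> T p"
  shows "g p v (\<Sum>i\<in>B. w i) = (\<Sum>i\<in>B. g p v (w i))"
  using assms(2) by (induction B rule: infinite_finite_induct) (simp_all add: assms(1) tangent_sum)

lemma g_sum_left:
  assumes "v \<in> T p" "\<And>i. i \<in> B \<Longrightarrow> w i \<in> T p"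
  shows "g p (\<Sum>i\<in>B. w i) v = (\<Sum>i\<in>B. g p (w i) v)"
  using assms(2) by (induction B rule: infinite_finite_induct) (simp_all add: assms(1) tangent_sum)

section \<open>The metric and the Christoffel symbols in coordinates\<close>

abbreviation gmat :: "('a, 'm) chart \<Rightarrow> 'a \<Rightarrow> real^'m^'m"
  where "gmat \<equiv> metric_matrix A g"

text \<open>The arguments are bare coordinate vectors because the form is also applied to connection
  terms, which do not transform like tangent vectors.\<close>

definition gform :: "('a, 'm) chart \<Rightarrow> 'a \<Rightarrow> real^'m \<Rightarrow> real^'m \<Rightarrow> real"
  where "gform c p x y = (\<Sum>i\<in>UNIV. \<Sum>j\<in>UNIV. x $ i * y $ j * gmat c p $ i $ j)"

lemma metric_in_coords:
  assumes c: "c \<in> A" "p \<in> chart_dom c" and v: "v \<in> T p" and w: "w \<in> T p"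
  shows "g p v w = gform c p (v c) (w c)"
proof -
  note cv = tangent_coord_vec[OF c]
  have "g p v w = g p (\<Sum>i\<in>UNIV. v c $ i *\<^sub>R coord_vec A c i p) (\<Sum>j\<in>UNIV. w c $ j *\<^sub>R coord_vec A c j p)"
    by (rule arg_cong2[OF tangent_expansion[OF c v] tangent_expansion[OF c w]])
  also have "\<dots> = (\<Sum>i\<in>UNIV. v c $ i * g p (coord_vec A c i p) (\<Sum>j\<in>UNIV. w c $ j *\<^sub>R coord_vec A c j p))"
    by (simp add: g_sum_left cv tangent_sum)
  finally show ?thesis
    by (simp add: g_sum_right cv gform_def metric_matrix_def sum_distrib_left mult.assoc)
qed

lemma gmat_sym:
  assumes "c \<in> A" "p \<in> chart_dom c"
  shows "gmat c p $ i $ j = gmat c p $ j $ i"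
  by (simp add: metric_matrix_def g_sym tangent_coord_vec assms)

lemma gform_sym:
  assumes "c \<in> A" "p \<in> chart_dom c"
  shows "gform c p x y = gform c p y x"
  unfolding gform_def by (subst sum.swap) (simp add: gmat_sym[OF assms] mult_ac)

text \<open>A vector \<open>x\<close> in the kernel represents a tangent vector of squared length
  x^T G x = 0 with G the metric matrix, so positive definiteness forces
  \<open>x = 0\<close>.\<close>

lemma invertible_gmat:
  assumes c: "c \<in> A" "p \<in> chart_dom c"
  shows "invertible (gmat c p)"
proof -
  have "x = 0" if "gmat c p *v x = 0" for x
  proof -
    let ?v = "of_coords A c p x"
    have "gform c p x x = (\<Sum>i\<in>UNIV. x $ i * (gmat c p *v x) $ i)"
      by (simp add: gform_def matrix_vector_mult_def sum_distrib_left mult_ac)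
    then have "g p ?v ?v = 0"
      using that by (simp add: metric_in_coords[OF c] of_coords_tangent[OF c] of_coords_self[OF c])
    then have "?v = 0"
      using g_pos of_coords_tangent[OF c] by force
    then show "x = 0"
      using of_coords_self[OF c, of x] by simp
  qed
  then show ?thesis
    by (metis invertible_left_inverse matrix_left_invertible_ker)
qed

lemma partial_cong:
  assumes c: "c \<in> A" "p \<in> chart_dom c" and "\<And>q. q \<in> chart_dom c \<Longrightarrow> h q = h' q"
  shows "partial c i h p = partial c i h' p"
proof -
  have p: "chart_map c p \<in> chart_img c" using c by blast
  have "frechet_derivative (h \<circ> chart_inv c) (at (chart_map c p) within chart_img c)
      = frechet_derivative (h' \<circ> chart_inv c) (at (chart_map c p) within chart_img c)"
    by (rule frechet_derivative_within_cong[OF p]) (use assms in auto)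
  then show ?thesis
    by (simp add: partial_def at_within_open[OF p open_chart_img[OF c(1)]])
qed

definition dgmat :: "('a, 'm) chart \<Rightarrow> 'a \<Rightarrow> 'm \<Rightarrow> 'm \<Rightarrow> 'm \<Rightarrow> real"
  where "dgmat c p l i j = partial c l (\<lambda>q. gmat c q $ i $ j) p"

lemma dgmat_sym: "c \<in> A \<Longrightarrow> p \<in> chart_dom c \<Longrightarrow> dgmat c p l i j = dgmat c p l j i"
  unfolding dgmat_def by (intro partial_cong gmat_sym)

text \<open>Multiplying by the metric matrix cancels its inverse and leaves the Christoffel symbols
  of the first kind.\<close>

lemma christoffel_lowered:
  assumes c: "c \<in> A" "p \<in> chart_dom c"
  shows "(\<Sum>k\<in>UNIV. gmat c p $ m $ k * christoffel A g c k i j p)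
    = (dgmat c p i j m + dgmat c p j i m - dgmat c p m i j) / 2"
proof -
  define d where "d l = (dgmat c p i j l + dgmat c p j i l - dgmat c p l i j) / 2" for l
  let ?M = "gmat c p"
  have inv: "?M ** matrix_inv ?M = mat 1"
    using someI_ex[OF invertible_gmat[OF c, unfolded invertible_def]] by (simp add: matrix_inv_def)
  have "(\<Sum>k\<in>UNIV. ?M $ m $ k * christoffel A g c k i j p)
      = (\<Sum>k\<in>UNIV. \<Sum>l\<in>UNIV. ?M $ m $ k * matrix_inv ?M $ k $ l * d l)"
    by (simp add: christoffel_def d_def dgmat_def sum_distrib_left mult_ac)
  also have "\<dots> = (\<Sum>l\<in>UNIV. (?M ** matrix_inv ?M) $ m $ l * d l)"
    by (subst sum.swap) (simp add: matrix_matrix_mult_def sum_distrib_right)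
  also have "\<dots> = d m"
    by (simp add: inv mat_def if_distrib[of "\<lambda>x. x * _"] cong: if_cong)
  finally show ?thesis by (simp add: d_def)
qed

lemma gform_connection:
  assumes c: "c \<in> A" "p \<in> chart_dom c"
  shows "gform c p y (connection_term A g c p x z) = (\<Sum>m\<in>UNIV. \<Sum>i\<in>UNIV. \<Sum>j\<in>UNIV.
    y $ m * x $ i * z $ j * ((dgmat c p i j m + dgmat c p j i m - dgmat c p m i j) / 2))"
proof -
  let ?G = "\<lambda>k i j. christoffel A g c k i j p"
  have "(\<Sum>k\<in>UNIV. y $ m * connection_term A g c p x z $ k * gmat c p $ m $ k)
      = (\<Sum>i\<in>UNIV. \<Sum>j\<in>UNIV. y $ m * x $ i * z $ j * (\<Sum>k\<in>UNIV. gmat c p $ m $ k * ?G k i j))" for m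
  proof -
    have "(\<Sum>k\<in>UNIV. y $ m * connection_term A g c p x z $ k * gmat c p $ m $ k)
      = (\<Sum>k\<in>UNIV. \<Sum>i\<in>UNIV. \<Sum>j\<in>UNIV. y $ m * x $ i * z $ j * (gmat c p $ m $ k * ?G k i j))"
      by (simp add: connection_term_def sum_distrib_left sum_distrib_right mult_ac)
    also have "\<dots> = (\<Sum>i\<in>UNIV. \<Sum>k\<in>UNIV. \<Sum>j\<in>UNIV. y $ m * x $ i * z $ j * (gmat c p $ m $ k * ?G k i j))"
      by (rule sum.swap)
    also have "\<dots> = (\<Sum>i\<in>UNIV. \<Sum>j\<in>UNIV. \<Sum>k\<in>UNIV. y $ m * x $ i * z $ j * (gmat c p $ m $ k * ?G k i j))"
      by (intro sum.cong refl sum.swap)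
    finally show ?thesis by (simp add: sum_distrib_left)
  qed
  then show ?thesis
    unfolding gform_def by (simp add: christoffel_lowered[OF c])
qed

text \<open>Metric compatibility in coordinates. In the sum of the two first-kind expressions the
  terms \<open>?D m i j\<close> and \<open>?D j i m\<close> cancel, and the symmetry of the metric
  makes the remaining two equal. The swaps of sums only give both expressions the same index names:
  \<open>m\<close> for \<open>y\<close>, \<open>j\<close> for \<open>z\<close>, \<open>i\<close> for
  \<open>x\<close>.\<close>

lemma connection_compatible:
  assumes c: "c \<in> A" "p \<in> chart_dom c"
  shows "gform c p (connection_term A g c p x y) z + gform c p y (connection_term A g c p x z)
    = (\<Sum>m\<in>UNIV. \<Sum>j\<in>UNIV. y $ m * z $ j * (\<Sum>i\<in>UNIV. x $ i * dgmat c p i m j))"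
proof -
  let ?D = "dgmat c p"
  have "gform c p (connection_term A g c p x y) z = (\<Sum>j\<in>UNIV. \<Sum>i\<in>UNIV. \<Sum>m\<in>UNIV.
      z $ j * x $ i * y $ m * ((?D i m j + ?D m i j - ?D j i m) / 2))"
    by (simp add: gform_sym[OF c, of _ z] gform_connection[OF c])
  also have "\<dots> = (\<Sum>j\<in>UNIV. \<Sum>m\<in>UNIV. \<Sum>i\<in>UNIV.
      z $ j * x $ i * y $ m * ((?D i m j + ?D m i j - ?D j i m) / 2))"
    by (intro sum.cong refl sum.swap)
  also have "\<dots> = (\<Sum>m\<in>UNIV. \<Sum>j\<in>UNIV. \<Sum>i\<in>UNIV.
      z $ j * x $ i * y $ m * ((?D i m j + ?D m i j - ?D j i m) / 2))"
    by (rule sum.swap)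
  finally have 1: "gform c p (connection_term A g c p x y) z = \<dots>" .
  have "gform c p y (connection_term A g c p x z) = (\<Sum>m\<in>UNIV. \<Sum>j\<in>UNIV. \<Sum>i\<in>UNIV.
      y $ m * x $ i * z $ j * ((?D i j m + ?D j i m - ?D m i j) / 2))"
    unfolding gform_connection[OF c] by (intro sum.cong refl sum.swap)
  then have "gform c p (connection_term A g c p x y) z + gform c p y (connection_term A g c p x z)
      = (\<Sum>m\<in>UNIV. \<Sum>j\<in>UNIV. \<Sum>i\<in>UNIV. z $ j * x $ i * y $ m * ((?D i m j + ?D m i j - ?D j i m) / 2)
        + y $ m * x $ i * z $ j * ((?D i j m + ?D j i m - ?D m i j) / 2))"
    using 1 by (simp add: sum.distrib)
  also have "\<dots> = (\<Sum>m\<in>UNIV. \<Sum>j\<in>UNIV. \<Sum>i\<in>UNIV. y $ m * z $ j * (x $ i * ?D i m j))"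
  proof (intro sum.cong refl)
    fix m j i
    show "z $ j * x $ i * y $ m * ((?D i m j + ?D m i j - ?D j i m) / 2)
        + y $ m * x $ i * z $ j * ((?D i j m + ?D j i m - ?D m i j) / 2)
      = y $ m * z $ j * (x $ i * ?D i m j)"
      using dgmat_sym[OF c, of i j m] by (simp add: field_simps)
  qed
  finally show ?thesis by (simp add: sum_distrib_left)
qed

lemma smooth_gmat:
  assumes "c \<in> A"
  shows "smooth_on (chart_img c) ((\<lambda>q. gmat c q $ i $ j) \<circ> chart_inv c)"
  using metric assms unfolding riemannian_metric_def by (simp add: metric_matrix_def)

end

section \<open>Differentiation along a curve\<close>

locale curve_in_riemannian = riemannian A g
  for A :: "('a::{t2_space,second_countable_topology}, 'm::finite) chart set" and g +
  fixes I :: "real set" and \<gamma> :: "real \<Rightarrow> 'a"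
  assumes smooth_curve: "smooth_curve A I \<gamma>"
begin

abbreviation vel :: "real \<Rightarrow> ('a, 'm) tvec"
  where "vel \<equiv> velocity A I \<gamma>"

definition chart_times :: "('a, 'm) chart \<Rightarrow> real set"
  where "chart_times c = {t \<in> I. \<gamma> t \<in> chart_dom c}"

text \<open>By continuity of the curve, \<open>chart_times c\<close> is relatively open in
  \<open>I\<close>. Smoothness of a curve is stated within the former set and velocities are taken
  within the latter; this makes the two kinds of derivative agree.\<close>

lemma at_within_chart_times:
  assumes c: "c \<in> A" and t: "t \<in> chart_times c"
  shows "at t within chart_times c = at t within I"
proof -
  have "openin (top_of_set I) (I \<inter> \<gamma> -` chart_dom c)"
    using smooth_curve open_chart_dom[OF c] unfolding smooth_curve_def
    by (intro continuous_openin_preimage_gen) auto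
  then obtain S where S: "open S" "I \<inter> \<gamma> -` chart_dom c = I \<inter> S"
    by (auto simp: openin_open)
  show ?thesis
    by (rule at_within_nhd[OF _ S(1)]) (use S(2) t in \<open>auto simp: chart_times_def\<close>)
qed

text \<open>A nondegenerate interval is connected with more than one point, so it has no isolated
  points. Derivatives within \<open>I\<close> are thus unique, also at endpoints.\<close>

lemma at_within_not_bot:
  assumes t: "t \<in> I"
  shows "at t within I \<noteq> bot"
proof -
  obtain a b where I: "is_interval I" "a \<in> I" "b \<in> I" "a < b"
    using smooth_curve unfolding smooth_curve_def nondegenerate_interval_def by blast
  then have "t islimpt I"
    using connected_imp_perfect[of I t] t is_interval_connected_1 by fastforce
  then show ?thesis using trivial_limit_within by blast
qed

lemma smooth_chart_curve: "c \<in> A \<Longrightarrow> C_k_on k (chart_times c) (chart_map c \<circ> \<gamma>)"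
  using smooth_curve unfolding smooth_curve_def smooth_on_def chart_times_def by blast

lemma chart_curve_has_derivative:
  assumes c: "c \<in> A" "t \<in> I" "\<gamma> t \<in> chart_dom c"
  shows "((chart_map c \<circ> \<gamma>) has_vector_derivative vel t c) (at t within I)"
proof -
  have t: "t \<in> chart_times c" using c by (simp add: chart_times_def)
  have "(chart_map c \<circ> \<gamma>) differentiable (at t within chart_times c)"
    using smooth_chart_curve[OF c(1), of "Suc 0"] t by (simp add: differentiable_on_def)
  then show ?thesis
    using c by (simp add: at_within_chart_times[OF c(1) t] vector_derivative_works velocity_def)
qed

lemma eventually_chart_times:
  assumes c: "c \<in> A" "t \<in> I" "\<gamma> t \<in> chart_dom c"
  shows "eventually (\<lambda>u. u \<in> chart_times c) (at t within I)"
proof -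
  have t: "t \<in> chart_times c" using c by (simp add: chart_times_def)
  have "eventually (\<lambda>u. u \<in> chart_times c) (at t within chart_times c)"
    by (simp add: eventually_at_filter)
  then show ?thesis by (simp add: at_within_chart_times[OF c(1) t])
qed

text \<open>The chain rule for \<open>h \<circ> chart_inv c\<close> after
  \<open>chart_map c \<circ> \<gamma>\<close>. The composite equals \<open>h (\<gamma> u)\<close>
  only while the curve stays in the chart, so the derivative is computed within
  \<open>chart_times c\<close> and then transferred to \<open>I\<close>.\<close>

lemma function_along_has_derivative:
  fixes h :: "'a \<Rightarrow> real"
  assumes c: "c \<in> A" "t \<in> I" "\<gamma> t \<in> chart_dom c"
    and h: "smooth_on (chart_img c) (h \<circ> chart_inv c)"
  shows "((\<lambda>u. h (\<gamma> u)) has_real_derivative (\<Sum>i\<in>UNIV. vel t c $ i * partial c i h (\<gamma> t))) (at t within I)"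
proof -
  have t: "t \<in> chart_times c" using c by (simp add: chart_times_def )
  let ?h = "h \<circ> chart_inv c"
  let ?D = "frechet_derivative ?h (at (chart_map c (\<gamma> t)))"
  have D: "(?h has_derivative ?D) (at (chart_map c (\<gamma> t)))"
    using c(3) by (intro smooth_on_has_derivative[OF open_chart_img[OF c(1)] h]) auto
  have x: "((chart_map c \<circ> \<gamma>) has_derivative (\<lambda>r. r *\<^sub>R vel t c)) (at t within chart_times c)"
    using chart_curve_has_derivative[OF c]
    unfolding at_within_chart_times[OF c(1) t] has_vector_derivative_def .
  have "((\<lambda>u. ?h ((chart_map c \<circ> \<gamma>) u)) has_derivative (\<lambda>r. ?D (r *\<^sub>R vel t c))) (at t within chart_times c)"
    by (rule has_derivative_compose[OF x]) (simp only: D comp_apply[of "chart_map c"])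
  then have "((\<lambda>u. h (\<gamma> u)) has_derivative (\<lambda>r. ?D (r *\<^sub>R vel t c))) (at t within chart_times c)"
    by (rule has_derivative_transform[rotated 2]) (use c(1) t in \<open>auto simp:  chart_times_def\<close>)
  moreover have lin: "linear ?D" using D has_derivative_linear by blast
  have "?D (r *\<^sub>R vel t c) = (\<Sum>i\<in>UNIV. vel t c $ i * partial c i h (\<gamma> t)) * r" for r
  proof -
    have "(\<Sum>i\<in>UNIV. vel t c $ i *\<^sub>R axis i 1) = vel t c"
      using basis_expansion[of "vel t c"] by (simp add: scalar_mult_eq_scaleR)
    then have "?D (vel t c) = ?D (\<Sum>i\<in>UNIV. vel t c $ i *\<^sub>R axis i 1)"
      by (rule arg_cong[OF sym])
    also have "\<dots> = (\<Sum>i\<in>UNIV. vel t c $ i * partial c i h (\<gamma> t))"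
      by (simp only: linear_sum[OF lin] linear_scale[OF lin] partial_def real_scaleR_def)
    finally show ?thesis
      by (simp only: linear_scale[OF lin] real_scaleR_def mult.commute)
  qed
  ultimately show ?thesis
    unfolding has_field_derivative_def at_within_chart_times[OF c(1) t] by simp
qed

lemma smooth_vector_field_along_has_derivative:
  assumes c: "c \<in> A" "t \<in> I" "\<gamma> t \<in> chart_dom c" and X: "smooth_vector_field A X"
  shows "((\<lambda>u. X (\<gamma> u) c) has_vector_derivative
    (\<chi> k. \<Sum>i\<in>UNIV. vel t c $ i * partial c i (\<lambda>q. X q c $ k) (\<gamma> t))) (at t within I)"
proof -
  have "smooth_on (chart_img c) ((\<lambda>q. X q c $ k) \<circ> chart_inv c)" for k
    using X c(1) C_k_on_bounded_linear[OF bounded_linear_vec_nth open_chart_img[OF c(1)], of _ "(\<lambda>q. X q c) \<circ> chart_inv c"]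
    by (simp add: smooth_vector_field_def smooth_on_def o_def)
  then have "((\<lambda>u. X (\<gamma> u) c $ k) has_real_derivative
      (\<Sum>i\<in>UNIV. vel t c $ i * partial c i (\<lambda>q. X q c $ k) (\<gamma> t))) (at t within I)" for k
    by (intro function_along_has_derivative c)
  then show ?thesis
    unfolding has_vector_derivative_def
    by (subst has_derivative_componentwise_within)
      (auto simp: Basis_vec_def inner_axis has_field_derivative_def mult_commute_abs)
qed

text \<open>Product rule for the coordinate sum: the derivative of the metric coefficients cancels
  against the two connection terms by \<open>connection_compatible\<close>. Differentiability is
  required at one time and in one chart only, which also suits the restriction to the curve of a
  global field such as \<open>\<xi> j\<close>.\<close>

lemma metric_along_has_derivative:
  assumes c: "c \<in> A" "t \<in> I" "\<gamma> t \<in> chart_dom c"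
    and tan: "\<And>u. u \<in> I \<Longrightarrow> V u \<in> T (\<gamma> u)" "\<And>u. u \<in> I \<Longrightarrow> U u \<in> T (\<gamma> u)" "V' \<in> T (\<gamma> t)" "U' \<in> T (\<gamma> t)"
    and V: "((\<lambda>u. V u c) has_vector_derivative
      V' c - connection_term A g c (\<gamma> t) (vel t c) (V t c)) (at t within I)"
    and U: "((\<lambda>u. U u c) has_vector_derivative
      U' c - connection_term A g c (\<gamma> t) (vel t c) (U t c)) (at t within I)"
  shows "((\<lambda>u. g (\<gamma> u) (V u) (U u)) has_real_derivative
    g (\<gamma> t) V' (U t) + g (\<gamma> t) (V t) U') (at t within I)"
proof -
  let ?C = "connection_term A g c (\<gamma> t) (vel t c)"
  let ?M = "\<lambda>u i j. gmat c (\<gamma> u) $ i $ j"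
  let ?dM = "\<lambda>i j. \<Sum>l\<in>UNIV. vel t c $ l * dgmat c (\<gamma> t) l i j"
  have Vk: "((\<lambda>u. V u c $ k) has_real_derivative (V' c - ?C (V t c)) $ k) (at t within I)"
    and Uk: "((\<lambda>u. U u c $ k) has_real_derivative (U' c - ?C (U t c)) $ k) (at t within I)" for k
    using bounded_linear.has_vector_derivative[OF bounded_linear_vec_nth V]
      bounded_linear.has_vector_derivative[OF bounded_linear_vec_nth U]
    by (simp_all add: has_real_derivative_iff_has_vector_derivative)
  have M: "((\<lambda>u. ?M u i j) has_real_derivative ?dM i j) (at t within I)" for i j
    unfolding dgmat_def by (intro function_along_has_derivative c smooth_gmat)
  have "((\<lambda>u. gform c (\<gamma> u) (V u c) (U u c)) has_real_derivative
      (\<Sum>i\<in>UNIV. \<Sum>j\<in>UNIV. ((V' c - ?C (V t c)) $ i * U t c $ j + (U' c - ?C (U t c)) $ j * V t c $ i) * ?M t i j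
        + ?dM i j * (V t c $ i * U t c $ j))) (at t within I)"
    unfolding gform_def by (intro DERIV_sum DERIV_mult Vk Uk M)
  also have "(\<Sum>i\<in>UNIV. \<Sum>j\<in>UNIV. ((V' c - ?C (V t c)) $ i * U t c $ j + (U' c - ?C (U t c)) $ j * V t c $ i) * ?M t i j
        + ?dM i j * (V t c $ i * U t c $ j))
      = gform c (\<gamma> t) (V' c) (U t c) + gform c (\<gamma> t) (V t c) (U' c)
        - (gform c (\<gamma> t) (?C (V t c)) (U t c) + gform c (\<gamma> t) (V t c) (?C (U t c)))
        + (\<Sum>i\<in>UNIV. \<Sum>j\<in>UNIV. V t c $ i * U t c $ j * ?dM i j)"
    by (simp add: gform_def algebra_simps sum.distrib sum_subtractf)
  also have "\<dots> = gform c (\<gamma> t) (V' c) (U t c) + gform c (\<gamma> t) (V t c) (U' c)"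
    by (simp add: connection_compatible[OF c(1,3)])
  finally have "((\<lambda>u. gform c (\<gamma> u) (V u c) (U u c)) has_real_derivative
      gform c (\<gamma> t) (V' c) (U t c) + gform c (\<gamma> t) (V t c) (U' c)) (at t within I)" .
  then have "((\<lambda>u. gform c (\<gamma> u) (V u c) (U u c)) has_real_derivative
      g (\<gamma> t) V' (U t) + g (\<gamma> t) (V t) U') (at t within I)"
    using tan c by (simp add: metric_in_coords[OF c(1,3)])
  \<comment> \<open>The coordinate expression represents the metric only as long as the curve
    remains in the chart, which it does for parameters near \<open>t\<close>.\<close>
  moreover have "eventually (\<lambda>u. gform c (\<gamma> u) (V u c) (U u c) = g (\<gamma> u) (V u) (U u)) (at t within I)"
    using eventually_chart_times[OF c]
    by eventually_elim (simp add: chart_times_def metric_in_coords[OF c(1)] tan)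
  moreover have "gform c (\<gamma> t) (V t c) (U t c) = g (\<gamma> t) (V t) (U t)"
    using tan c by (simp add: metric_in_coords[OF c(1,3)])
  ultimately show ?thesis
    unfolding has_field_derivative_def by (rule has_derivative_transform_eventually) (rule c(2))
qed

end


section \<open>Fields along a curve\<close>

text \<open>Pairing with the fixed vector \<open>e t\<close> recovers \<open>k\<close> as a quotient
  of differentiable functions whose denominator is nonzero near \<open>t\<close>. It provides
  differentiability of coefficients, such as a curvature, about which only a product with a field is
  known.\<close>

lemma scalar_factor_differentiable:
  fixes e :: "real \<Rightarrow> 'b::real_inner" and k :: "real \<Rightarrow> real"
  assumes e: "e differentiable (at t within S)" and ke: "(\<lambda>u. k u *\<^sub>R e u) differentiable (at t within S)"
    and t: "t \<in> S" "e t \<noteq> 0"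
  shows "k differentiable (at t within S)"
proof -
  let ?k = "\<lambda>u. ((k u *\<^sub>R e u) \<bullet> e t) / (e u \<bullet> e t)"
  have inner: "(\<lambda>u. f u \<bullet> e t) differentiable (at t within S)"
    if "f differentiable (at t within S)" for f :: "real \<Rightarrow> 'b"
    using that bounded_linear.has_derivative[OF bounded_linear_inner_left]
    unfolding differentiable_def by blast
  have "?k differentiable (at t within S)"
    using t(2) by (intro differentiable_divide inner e ke) auto
  moreover have "eventually (\<lambda>u. e u \<bullet> e t \<noteq> 0) (at t within S)"
  proof -
    have "((\<lambda>u. e u \<bullet> e t) \<longlongrightarrow> e t \<bullet> e t) (at t within S)"
      using differentiable_imp_continuous_within[OF inner[OF e]] by (simp add: continuous_within)
    then show ?thesis by (rule tendsto_imp_eventually_ne) (use t(2) in simp)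
  qed
  then have "eventually (\<lambda>u. ?k u = k u) (at t within S)"
    by eventually_elim simp
  ultimately show ?thesis
    using t has_derivative_transform_eventually[of ?k _ t S k] unfolding differentiable_def by fastforce
qed

lemma real_derivative_transform:
  assumes "t \<in> S" "\<And>u. u \<in> S \<Longrightarrow> h' u = h u" "(h has_real_derivative D) (at t within S)"
  shows "(h' has_real_derivative D) (at t within S)"
  using has_derivative_transform[OF assms(1,2)] assms(3) by (simp add: has_field_derivative_def)

lemma connection_term_scaleR:
  "connection_term A g c p x (r *\<^sub>R y) = r *\<^sub>R connection_term A g c p x y"
  by (simp add: connection_term_def vec_eq_iff sum_distrib_left mult_ac)

context curve_in_riemannian
begin

abbreviation has_cov_deriv :: "(real \<Rightarrow> ('a, 'm) tvec) \<Rightarrow> (real \<Rightarrow> ('a, 'm) tvec) \<Rightarrow> bool"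
  where "has_cov_deriv \<equiv> has_cov_deriv_along A g I \<gamma>"

lemma real_derivative_unique:
  assumes "t \<in> I" "(h has_real_derivative x) (at t within I)" "(h has_real_derivative y) (at t within I)"
  shows "x = y"
  using vector_derivative_unique_within[OF at_within_not_bot[OF assms(1)]] assms(2,3)
  by (simp add: has_real_derivative_iff_has_vector_derivative)

lemma has_cov_derivD:
  assumes "has_cov_deriv V W" "t \<in> I"
  shows "V t \<in> T (\<gamma> t)" "W t \<in> T (\<gamma> t)"
    and "c \<in> A \<Longrightarrow> \<gamma> t \<in> chart_dom c \<Longrightarrow> ((\<lambda>u. V u c) has_vector_derivative
      W t c - connection_term A g c (\<gamma> t) (vel t c) (V t c)) (at t within I)"
  using assms unfolding has_cov_deriv_along_def by blast+

text \<open>The fields in the definition of C-parallelity are given by existence only; uniqueness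
  identifies them with the ones computed from the Frenet equations.\<close>

lemma has_cov_deriv_unique:
  assumes "has_cov_deriv V W" "has_cov_deriv V W'" "t \<in> I"
  shows "W t = W' t"
proof -
  obtain c where c: "c \<in> A" "\<gamma> t \<in> chart_dom c" using chart_exists by blast
  have "W t c = W' t c"
    using vector_derivative_unique_within[OF at_within_not_bot[OF assms(3)]
        has_cov_derivD(3)[OF assms(1,3) c] has_cov_derivD(3)[OF assms(2,3) c]] by simp
  then show ?thesis
    using tangent_eqI[OF _ _ c] has_cov_derivD(2) assms by blast
qed

lemma has_cov_deriv_cong:
  assumes "has_cov_deriv V W" "\<And>t. t \<in> I \<Longrightarrow> V t = V' t" "\<And>t. t \<in> I \<Longrightarrow> W t = W' t"
  shows "has_cov_deriv V' W'"
  unfolding has_cov_deriv_along_def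
proof (intro ballI conjI impI)
  fix t assume t: "t \<in> I"
  show "V' t \<in> T (\<gamma> t)" "W' t \<in> T (\<gamma> t)"
    using has_cov_derivD(1,2)[OF assms(1) t] assms(2,3) t by auto
  fix c assume c: "c \<in> A" "\<gamma> t \<in> chart_dom c"
  show "((\<lambda>u. V' u c) has_vector_derivative
      W' t c - connection_term A g c (\<gamma> t) (vel t c) (V' t c)) (at t within I)"
    by (rule has_vector_derivative_transform[OF t, of _ "\<lambda>u. V u c"])
      (use has_cov_derivD(3)[OF assms(1) t c] in \<open>simp_all add: assms(2,3) t\<close>)
qed

lemma has_cov_deriv_scaleR:
  assumes V: "has_cov_deriv V W" and k: "\<And>t. t \<in> I \<Longrightarrow> (k has_real_derivative k' t) (at t within I)"
  shows "has_cov_deriv (\<lambda>t. k t *\<^sub>R V t) (\<lambda>t. k' t *\<^sub>R V t + k t *\<^sub>R W t)"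
  unfolding has_cov_deriv_along_def
proof (intro ballI conjI impI)
  fix t assume t: "t \<in> I"
  show "k t *\<^sub>R V t \<in> T (\<gamma> t)" "k' t *\<^sub>R V t + k t *\<^sub>R W t \<in> T (\<gamma> t)"
    using has_cov_derivD(1,2)[OF V t] by simp_all
  fix c assume c: "c \<in> A" "\<gamma> t \<in> chart_dom c"
  show "((\<lambda>u. (k u *\<^sub>R V u) c) has_vector_derivative (k' t *\<^sub>R V t + k t *\<^sub>R W t) c -
      connection_term A g c (\<gamma> t) (vel t c) ((k t *\<^sub>R V t) c)) (at t within I)"
    using has_vector_derivative_scaleR[OF k[OF t] has_cov_derivD(3)[OF V t c]]
    by (simp add: connection_term_scaleR algebra_simps)
qed

lemma has_cov_deriv_differentiable:
  assumes "has_cov_deriv V W" "t \<in> I" "c \<in> A" "\<gamma> t \<in> chart_dom c"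
  shows "(\<lambda>u. V u c) differentiable (at t within I)"
  using has_cov_derivD(3)[OF assms] differentiableI_vector by blast

lemma factor_along_differentiable:
  assumes V: "has_cov_deriv V W" and t: "t \<in> I" "V t \<noteq> 0"
    and X: "\<And>c. c \<in> A \<Longrightarrow> \<gamma> t \<in> chart_dom c \<Longrightarrow> (\<lambda>u. k u *\<^sub>R V u c) differentiable (at t within I)"
  shows "k differentiable (at t within I)"
proof -
  obtain c where c: "c \<in> A" "\<gamma> t \<in> chart_dom c" using chart_exists by blast
  have "V t c \<noteq> 0"
    using tangent_eqI[OF has_cov_derivD(1)[OF V t(1)] tangent_zero c] t(2) by auto
  then show ?thesis
    using scalar_factor_differentiable has_cov_deriv_differentiable[OF V t(1) c] X[OF c] t(1) by blast
qed

lemma velocity_differentiable: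
  assumes c: "c \<in> A" "t \<in> I" "\<gamma> t \<in> chart_dom c"
  shows "(\<lambda>u. vel u c) differentiable (at t within I)"
proof -
  let ?J = "chart_times c" and ?x = "chart_map c \<circ> \<gamma>"
  have J: "u \<in> I" "\<gamma> u \<in> chart_dom c" if "u \<in> ?J" for u
    using that by (auto simp: chart_times_def)
  have t: "t \<in> ?J" using c by (simp add: chart_times_def)
  \<comment> \<open>The coordinate curve is C^2, and its derivative in direction 1 is the coordinate
    velocity.\<close>
  have "(\<lambda>u. frechet_derivative ?x (at u within ?J) 1) differentiable (at t within ?J)"
    using smooth_chart_curve[OF c(1), of "Suc (Suc 0)"] t by (simp add: differentiable_on_def)
  moreover have "frechet_derivative ?x (at u within ?J) 1 = vel u c" if u: "u \<in> ?J" for u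
  proof -
    have "?x differentiable (at u within ?J)"
      using smooth_chart_curve[OF c(1), of "Suc 0"] u by (simp add: differentiable_on_def)
    then have D: "(?x has_derivative frechet_derivative ?x (at u within ?J)) (at u within ?J)"
      by (simp add: frechet_derivative_works)
    have eq: "frechet_derivative ?x (at u within ?J) = (\<lambda>r. r *\<^sub>R frechet_derivative ?x (at u within ?J) 1)"
    proof
      show "frechet_derivative ?x (at u within ?J) r = r *\<^sub>R frechet_derivative ?x (at u within ?J) 1" for r
        using linear_scale[OF has_derivative_linear[OF D], of r 1] by simp
    qed
    have "(?x has_vector_derivative frechet_derivative ?x (at u within ?J) 1) (at u within ?J)"
      unfolding has_vector_derivative_def by (rule has_derivative_eq_rhs[OF D eq])
    then show ?thesis
      using vector_derivative_unique_within[OF at_within_not_bot[OF J(1)[OF u]]]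
        chart_curve_has_derivative[OF c(1) J[OF u]] at_within_chart_times[OF c(1) u] by metis
  qed
  ultimately have "(\<lambda>u. vel u c) differentiable (at t within ?J)"
    by (rule differentiable_transform_within[OF _ zero_less_one t])
  then show ?thesis by (simp add: at_within_chart_times[OF c(1) t])
qed

text \<open>Near each time the derivative is a sum of velocity components times partial derivatives
  of \<open>h\<close>, and all these factors are differentiable along the curve. Applied to \<beta>
  along the curve, it yields the differentiability of \<lambda> that C-parallelity demands.\<close>

lemma derivative_of_smooth_function_along_differentiable:
  assumes h: "smooth_function A h"
    and d: "\<And>t. t \<in> I \<Longrightarrow> ((\<lambda>u. h (\<gamma> u)) has_real_derivative d t) (at t within I)"
  shows "d differentiable_on I"
  unfolding differentiable_on_def
proof
  fix t assume t: "t \<in> I"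
  obtain c where c: "c \<in> A" "\<gamma> t \<in> chart_dom c" using chart_exists by blast
  have hc: "smooth_on (chart_img c) (h \<circ> chart_inv c)"
    using h c(1) by (simp add: smooth_function_def)
  let ?d = "\<lambda>u. \<Sum>i\<in>UNIV. vel u c $ i * partial c i h (\<gamma> u)"
  have "(\<lambda>u. vel u c $ i) differentiable (at t within I)" for i
    using velocity_differentiable[OF c(1) t c(2)] bounded_linear.has_derivative[OF bounded_linear_vec_nth]
    unfolding differentiable_def by blast
  moreover have "(\<lambda>u. partial c i h (\<gamma> u)) differentiable (at t within I)" for i
  proof -
    have "smooth_on (chart_img c) (partial c i h \<circ> chart_inv c)"
      using smooth_on_frechet_derivative[OF open_chart_img[OF c(1)] hc, of "axis i 1"]
      unfolding smooth_on_def
      by (elim all_forward C_k_on_cong[THEN iffD1, rotated]) (use c(1) in \<open>auto simp: partial_def\<close>)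
    then show ?thesis
      using function_along_has_derivative[OF c(1) t c(2)] unfolding real_differentiable_def by blast
  qed
  ultimately have "?d differentiable (at t within I)"
    by (intro differentiable_sum differentiable_mult) auto
  moreover have "eventually (\<lambda>u. ?d u = d u) (at t within I)"
    using eventually_chart_times[OF c(1) t c(2)]
  proof eventually_elim
    case (elim u)
    then have u: "u \<in> I" "\<gamma> u \<in> chart_dom c" by (auto simp: chart_times_def)
    show ?case
      by (rule real_derivative_unique[OF u(1) function_along_has_derivative[OF c(1) u hc] d[OF u(1)]])
  qed
  moreover have "?d t = d t"
    by (rule real_derivative_unique[OF t function_along_has_derivative[OF c(1) t c(2) hc] d[OF t]])
  ultimately show "d differentiable (at t within I)"
    using t has_derivative_transform_eventually[of ?d _ t I d] unfolding differentiable_def by blast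
qed

end


section \<open>Legendre curves in trans-S-manifolds\<close>

locale legendre_curve_in_trans_S_manifold =
  fixes A :: "('a::{t2_space,second_countable_topology}, 'm::finite) chart set"
    and n s :: nat
    and f :: "'a \<Rightarrow> ('a, 'm) tvec \<Rightarrow> ('a, 'm) tvec"
    and \<xi> :: "nat \<Rightarrow> 'a \<Rightarrow> ('a, 'm) tvec"
    and \<eta> :: "nat \<Rightarrow> 'a \<Rightarrow> ('a, 'm) tvec \<Rightarrow> real"
    and g :: "'a \<Rightarrow> ('a, 'm) tvec \<Rightarrow> ('a, 'm) tvec \<Rightarrow> real"
    and \<alpha> \<beta> :: "nat \<Rightarrow> 'a \<Rightarrow> real"
    and I :: "real set" and \<gamma> :: "real \<Rightarrow> 'a"
    and E :: "nat \<Rightarrow> real \<Rightarrow> ('a, 'm) tvec" and \<kappa> :: "nat \<Rightarrow> real \<Rightarrow> real"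
  assumes trans_S: "trans_S_manifold A n s f \<xi> \<eta> g \<alpha> \<beta>"
    and frenet: "frenet_curve A g I \<gamma> 2 E \<kappa>"
    and legendre: "legendre_curve A s \<eta> I \<gamma>"
begin

lemma framed: "framed_metric_f_manifold A n s f \<xi> \<eta> g"
  using trans_S by (simp add: trans_S_manifold_def)

sublocale curve_in_riemannian A g I \<gamma>
  using framed frenet
  by unfold_locales (simp_all add: framed_metric_f_manifold_def frenet_curve_def)

abbreviation \<zeta> :: "'a \<Rightarrow> ('a, 'm) tvec"
  where "\<zeta> p \<equiv> \<Sum>i=1..s. \<xi> i p"

section \<open>Pointwise identities and the covariant derivative of the structure fields\<close>

lemma s_pos: "s \<ge> 1"
  using framed by (simp add: framed_metric_f_manifold_def)

lemma f_tangent: "v \<in> T p \<Longrightarrow> f p v \<in> T p"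
proof -
  have "tensor_field_1_1 A f" using framed by (simp add: framed_metric_f_manifold_def)
  then show "v \<in> T p \<Longrightarrow> f p v \<in> T p" unfolding tensor_field_1_1_def by blast
qed

lemma f_f: "v \<in> T p \<Longrightarrow> f p (f p v) = - v + (\<Sum>i=1..s. \<eta> i p v *\<^sub>R \<xi> i p)"
  using framed unfolding framed_metric_f_manifold_def by blast

lemma g_f: "v \<in> T p \<Longrightarrow> w \<in> T p \<Longrightarrow>
    g p (f p v) (f p w) = g p v w - (\<Sum>i=1..s. \<eta> i p v * \<eta> i p w)"
  using framed unfolding framed_metric_f_manifold_def by blast

lemma
  assumes "i \<in> {1..s}"
  shows xi_smooth: "smooth_vector_field A (\<xi> i)"
    and f_xi: "f p (\<xi> i p) = 0"
    and eta_f: "v \<in> T p \<Longrightarrow> \<eta> i p (f p v) = 0"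
    and eta_eq: "v \<in> T p \<Longrightarrow> \<eta> i p v = g p v (\<xi> i p)"
    and eta_xi: "j \<in> {1..s} \<Longrightarrow> \<eta> i p (\<xi> j p) = (if i = j then 1 else 0)"
  using framed assms unfolding framed_metric_f_manifold_def by blast+

lemma beta_smooth: "i \<in> {1..s} \<Longrightarrow> smooth_function A (\<beta> i)"
  using trans_S unfolding trans_S_manifold_def by blast

lemma xi_tangent: "i \<in> {1..s} \<Longrightarrow> \<xi> i p \<in> T p"
  using xi_smooth unfolding smooth_vector_field_def by blast

lemma zeta_tangent: "\<zeta> p \<in> T p"
  by (intro tangent_sum xi_tangent)

lemma g_xi_xi: "i \<in> {1..s} \<Longrightarrow> j \<in> {1..s} \<Longrightarrow> g p (\<xi> i p) (\<xi> j p) = (if i = j then 1 else 0)"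
  using eta_eq[of j "\<xi> i p" p] eta_xi[of j i p] xi_tangent by auto

lemma g_zeta_xi:
  assumes "j \<in> {1..s}"
  shows "g p (\<zeta> p) (\<xi> j p) = 1"
proof -
  have "g p (\<zeta> p) (\<xi> j p) = (\<Sum>i=1..s. g p (\<xi> i p) (\<xi> j p))"
    by (intro g_sum_left xi_tangent assms)
  also have "\<dots> = (\<Sum>i=1..s. if i = j then 1 else 0)"
    by (intro sum.cong refl g_xi_xi assms)
  finally show ?thesis using assms by simp
qed

lemma g_zeta_zeta: "g p (\<zeta> p) (\<zeta> p) = s"
proof -
  have "g p (\<zeta> p) (\<zeta> p) = (\<Sum>j=1..s. g p (\<zeta> p) (\<xi> j p))"
    by (intro g_sum_right xi_tangent zeta_tangent)
  then show ?thesis by (simp add: g_zeta_xi[unfolded One_nat_def])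
qed

text \<open>Disposes of the covariant derivative of \<open>f\<close> applied to
  \<open>\<xi> j\<close>, which vanishes identically.\<close>

lemma levi_civita_zero: "levi_civita A g X (\<lambda>q. 0) p = 0"
proof -
  have "partial c i (\<lambda>q. 0) p = 0" for c :: "('a, 'm) chart" and i p
    by (simp add: partial_def o_def)
  then show ?thesis
    using of_coords_0[OF chart_at] by (simp add: levi_civita_def connection_term_def Let_def flip: zero_vec_def)
qed

text \<open>On horizontal vectors \<open>f\<close> is an isometry with square -1, hence skew:
  comparing \<open>f p v\<close> and \<open>f p (f p v)\<close> with \<open>v\<close> and
  \<open>f p v\<close> shows that the number equals its own negative.\<close>

lemma g_f_self: assumes "v \<in> T p" "\<And>i. i \<in> {1..s} \<Longrightarrow> \<eta> i p v = 0"
  shows "g p (f p v) v = 0"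
proof -
  have "f p (f p v) = - v"
    using f_f[of v p] assms by simp
  moreover have "g p (f p v) (f p (f p v)) = g p v (f p v)"
    using g_f[of v p "f p v"] assms f_tangent eta_f by simp
  ultimately have "- g p (f p v) v = g p (f p v) v"
    using assms(1) f_tangent g_sym[of v p "f p v"] by simp
  then show ?thesis by simp
qed

text \<open>The defining equation of a trans-S-manifold with \<open>Y = \<xi>\<^sub>j\<close> gives
  \<open>f (\<nabla>\<^sub>X \<xi>\<^sub>j) = \<beta>\<^sub>j f X - \<alpha>\<^sub>j f\<^sup>2 X\<close>; pair it with \<open>f X\<close>.\<close>

lemma g_levi_civita_xi:
  assumes X: "smooth_vector_field A X" and j: "j \<in> {1..s}"
    and horizontal: "\<And>i. i \<in> {1..s} \<Longrightarrow> \<eta> i p (X p) = 0"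
  shows "g p (X p) (levi_civita A g X (\<xi> j) p) = \<beta> j p * g p (X p) (X p)"
proof -
  let ?x = "X p" and ?L = "levi_civita A g X (\<xi> j) p"
  have x: "?x \<in> T p" using X by (simp add: smooth_vector_field_def)
  have L: "?L \<in> T p"
    unfolding levi_civita_def Let_def by (intro of_coords_tangent chart_at)
  have fx: "f p ?x \<in> T p" "f p (f p ?x) \<in> T p" using x f_tangent by auto
  have ffx: "f p (f p ?x) = (- 1) *\<^sub>R ?x"
    using f_f[OF x] horizontal by simp
  have "levi_civita A g X (\<lambda>q. f q (\<xi> j q)) p - f p ?L = (\<Sum>i=1..s.
      \<alpha> i p *\<^sub>R (g p (f p ?x) (f p (\<xi> j p)) *\<^sub>R \<xi> i p + \<eta> i p (\<xi> j p) *\<^sub>R f p (f p ?x))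
      + \<beta> i p *\<^sub>R (g p (f p ?x) (\<xi> j p) *\<^sub>R \<xi> i p - \<eta> i p (\<xi> j p) *\<^sub>R f p ?x))"
    using trans_S X xi_smooth[OF j] unfolding trans_S_manifold_def by blast
  \<comment> \<open>Both metric coefficients vanish, as \<open>f\<close> kills
    \<open>\<xi> j\<close> and \<open>f p ?x\<close> is orthogonal to it; duality of
    \<open>\<eta>\<close> and \<open>\<xi>\<close> leaves the summand \<open>i = j\<close>.\<close>
  also have "\<dots> = (\<Sum>i=1..s. if i = j then \<alpha> j p *\<^sub>R f p (f p ?x) - \<beta> j p *\<^sub>R f p ?x else 0)"
    using j fx eta_f[OF j x] eta_eq[OF j fx(1)]
    by (intro sum.cong refl) (simp add: f_xi eta_xi)
  finally have "- f p ?L = \<alpha> j p *\<^sub>R f p (f p ?x) - \<beta> j p *\<^sub>R f p ?x"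
    using j by (simp add: f_xi levi_civita_zero)
  then have "f p ?L = \<alpha> j p *\<^sub>R ?x + \<beta> j p *\<^sub>R f p ?x"
    unfolding ffx by (simp add: algebra_simps)
  \<comment> \<open>The \<alpha> term drops out by skewness, and on the horizontal vector
    \<open>?x\<close> the map \<open>f\<close> preserves length. Afterwards \<open>g_f\<close> also
    removes \<open>f\<close> on the left-hand side.\<close>
  then have "g p (f p ?x) (f p ?L) = \<beta> j p * g p ?x ?x"
    using x fx horizontal g_f_self[OF x] by (simp add: g_f)
  then show ?thesis
    using x L horizontal by (simp add: g_f)
qed

section \<open>The Frenet equations of order 2\<close>

lemma frenet_frame:
  shows "t \<in> I \<Longrightarrow> E 1 t = vel t"
    and "t \<in> I \<Longrightarrow> i \<in> {1..2} \<Longrightarrow> j \<in> {1..2} \<Longrightarrow> g (\<gamma> t) (E i t) (E j t) = (if i = j then 1 else 0)"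
    and "j \<in> {1..2} \<Longrightarrow> has_cov_deriv (E j) (\<lambda>t. (if j = 1 then 0 else - \<kappa> (j - 1) t *\<^sub>R E (j - 1) t)
      + (if j = 2 then 0 else \<kappa> j t *\<^sub>R E (j + 1) t))"
  using frenet unfolding frenet_curve_def by blast+

lemma frenet_facts:
  assumes t: "t \<in> I"
  shows "E 1 t = vel t" "g (\<gamma> t) (E 2 t) (E 2 t) = 1" "g (\<gamma> t) (vel t) (vel t) = 1"
    "g (\<gamma> t) (E 2 t) (vel t) = 0"
proof -
  show vel: "E 1 t = vel t" by (rule frenet_frame(1)[OF t])
  show "g (\<gamma> t) (E 2 t) (E 2 t) = 1" by (simp add: frenet_frame(2)[OF t])
  show "g (\<gamma> t) (vel t) (vel t) = 1" "g (\<gamma> t) (E 2 t) (vel t) = 0"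
    using frenet_frame(2)[OF t, of 1 1] frenet_frame(2)[OF t, of 2 1] by (simp_all add: vel[unfolded One_nat_def])
qed

lemma cov_deriv_vel: "has_cov_deriv vel (\<lambda>t. \<kappa> 1 t *\<^sub>R E 2 t)"
proof (rule has_cov_deriv_cong)
  show "has_cov_deriv (E 1) (\<lambda>t. (if 1 = (1::nat) then 0 else - \<kappa> (1 - 1) t *\<^sub>R E (1 - 1) t)
      + (if 1 = (2::nat) then 0 else \<kappa> 1 t *\<^sub>R E (1 + 1) t))"
    by (rule frenet_frame(3)) simp
qed (simp_all only: frenet_facts(1), simp add: numeral_2_eq_2)

lemma cov_deriv_E2: "has_cov_deriv (E 2) (\<lambda>t. - \<kappa> 1 t *\<^sub>R vel t)"
proof (rule has_cov_deriv_cong)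
  show "has_cov_deriv (E 2) (\<lambda>t. (if 2 = (1::nat) then 0 else - \<kappa> (2 - 1) t *\<^sub>R E (2 - 1) t)
      + (if 2 = (2::nat) then 0 else \<kappa> 2 t *\<^sub>R E (2 + 1) t))"
    by (rule frenet_frame(3)) simp
qed (simp_all add: frenet_facts(1)[unfolded One_nat_def])

lemma vel_tangent: "t \<in> I \<Longrightarrow> vel t \<in> T (\<gamma> t)"
  and E2_tangent: "t \<in> I \<Longrightarrow> E 2 t \<in> T (\<gamma> t)"
  using has_cov_derivD(1)[OF cov_deriv_vel] has_cov_derivD(1)[OF cov_deriv_E2] by blast+

lemma E2_nonzero: "t \<in> I \<Longrightarrow> E 2 t \<noteq> 0"
  using frenet_facts(2)[of t] E2_tangent[of t] by auto

text \<open>The derivative of the vanishing function g(T, \<xi>_j) consists of the curvature term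
  and of g applied to T and the derivative of \<xi>_j, which is \<beta>_j because T is a horizontal
  unit vector.\<close>

lemma curvature_beta:
  assumes t: "t \<in> I" and j: "j \<in> {1..s}"
  shows "\<kappa> 1 t * g (\<gamma> t) (E 2 t) (\<xi> j (\<gamma> t)) + \<beta> j (\<gamma> t) = 0"
proof -
  let ?p = "\<gamma> t"
  define c where "c = chart_at A ?p"
  have c: "c \<in> A" "?p \<in> chart_dom c" unfolding c_def by (rule chart_at)+
  \<comment> \<open>Agreement with the velocity at this single point suffices, since
    \<open>levi_civita\<close> at a point depends on its first argument only through the value
    there.\<close>
  obtain X where X: "smooth_vector_field A X" "X ?p = vel t"
    using smooth_vector_field_extension[OF vel_tangent[OF t]] by blast
  let ?L = "levi_civita A g X (\<xi> j) ?p"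
  have L: "?L \<in> T ?p"
    unfolding levi_civita_def Let_def by (intro of_coords_tangent chart_at)
  have "?L c = (\<chi> k. \<Sum>i\<in>UNIV. vel t c $ i * partial c i (\<lambda>q. \<xi> j q c $ k) ?p)
      + connection_term A g c ?p (vel t c) (\<xi> j ?p c)"
    unfolding levi_civita_def Let_def c_def[symmetric] X(2) by (rule of_coords_self[OF c])
  \<comment> \<open>So \<open>?L\<close> is the covariant derivative of \<open>\<xi> j\<close> along
    the curve at time \<open>t\<close>; the chart is \<open>chart_at\<close> because
    \<open>levi_civita\<close> is evaluated in it.\<close>
  then have xi: "((\<lambda>u. \<xi> j (\<gamma> u) c) has_vector_derivative
      ?L c - connection_term A g c ?p (vel t c) (\<xi> j ?p c)) (at t within I)"
    using smooth_vector_field_along_has_derivative[OF c(1) t c(2) xi_smooth[OF j]] by simp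
  have "((\<lambda>u. g (\<gamma> u) (vel u) (\<xi> j (\<gamma> u))) has_real_derivative
      g ?p (\<kappa> 1 t *\<^sub>R E 2 t) (\<xi> j ?p) + g ?p (vel t) ?L) (at t within I)"
    using vel_tangent xi_tangent[OF j] L t E2_tangent
    by (intro metric_along_has_derivative[OF c(1) t c(2)] xi has_cov_derivD(3)[OF cov_deriv_vel t c]) auto
  moreover have eta: "\<eta> i (\<gamma> u) (vel u) = 0" if "u \<in> I" "i \<in> {1..s}" for u i
    using legendre that unfolding legendre_curve_def by blast
  have "((\<lambda>u. g (\<gamma> u) (vel u) (\<xi> j (\<gamma> u))) has_real_derivative 0) (at t within I)"
    by (rule real_derivative_transform[OF t, of _ "\<lambda>_. 0"])
      (simp_all add: eta[OF _ j] flip: eta_eq[OF j vel_tangent])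
  ultimately have "g ?p (\<kappa> 1 t *\<^sub>R E 2 t) (\<xi> j ?p) + g ?p (vel t) ?L = 0"
    by (rule real_derivative_unique[OF t])
  moreover have "g ?p (vel t) ?L = \<beta> j ?p"
    using g_levi_civita_xi[OF X(1) j, of ?p] eta[OF t] frenet_facts(3)[OF t] by (simp add: X(2))
  ultimately show ?thesis
    using E2_tangent[OF t] xi_tangent[OF j] by simp
qed

text \<open>The covariant derivative of the mean curvature field is \<kappa>' E_2 - \<kappa>^2 T; as
  E_2 is orthogonal to T, the projection removes exactly the second term.\<close>

lemma normal_deriv_mean_curvature:
  assumes k: "\<And>t. t \<in> I \<Longrightarrow> (\<kappa> 1 has_real_derivative k' t) (at t within I)"
  shows "has_cov_deriv (\<lambda>t. \<kappa> 1 t *\<^sub>R E 2 t) (\<lambda>t. k' t *\<^sub>R E 2 t + \<kappa> 1 t *\<^sub>R (- \<kappa> 1 t *\<^sub>R vel t))"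
    and "t \<in> I \<Longrightarrow> (k' t *\<^sub>R E 2 t + \<kappa> 1 t *\<^sub>R (- \<kappa> 1 t *\<^sub>R vel t))
      - g (\<gamma> t) (k' t *\<^sub>R E 2 t + \<kappa> 1 t *\<^sub>R (- \<kappa> 1 t *\<^sub>R vel t)) (vel t) *\<^sub>R vel t = k' t *\<^sub>R E 2 t"
proof -
  show "has_cov_deriv (\<lambda>t. \<kappa> 1 t *\<^sub>R E 2 t) (\<lambda>t. k' t *\<^sub>R E 2 t + \<kappa> 1 t *\<^sub>R (- \<kappa> 1 t *\<^sub>R vel t))"
    by (rule has_cov_deriv_scaleR[OF cov_deriv_E2 k])
  assume t: "t \<in> I"
  have tan: "\<kappa> 1 t *\<^sub>R (- \<kappa> 1 t *\<^sub>R vel t) \<in> T (\<gamma> t)" "- \<kappa> 1 t *\<^sub>R vel t \<in> T (\<gamma> t)"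
    "k' t *\<^sub>R E 2 t \<in> T (\<gamma> t)"
    using vel_tangent[OF t] E2_tangent[OF t] tangent_scaleR by blast+
  have "g (\<gamma> t) (k' t *\<^sub>R E 2 t + \<kappa> 1 t *\<^sub>R (- \<kappa> 1 t *\<^sub>R vel t)) (vel t) = \<kappa> 1 t * - \<kappa> 1 t"
    by (simp only: g_add_left g_scale_left tan vel_tangent[OF t] E2_tangent[OF t] frenet_facts[OF t])
  then show "(k' t *\<^sub>R E 2 t + \<kappa> 1 t *\<^sub>R (- \<kappa> 1 t *\<^sub>R vel t))
      - g (\<gamma> t) (k' t *\<^sub>R E 2 t + \<kappa> 1 t *\<^sub>R (- \<kappa> 1 t *\<^sub>R vel t)) (vel t) *\<^sub>R vel t = k' t *\<^sub>R E 2 t"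
    by (simp add: algebra_simps)
qed

section \<open>The two implications and the equivalence\<close>

lemma C_parallel_imp:
  assumes lam: "\<forall>t\<in>I. lam t \<noteq> 0" and par: "C_parallel_normal A s \<xi> g I \<gamma> lam"
  obtains \<sigma> b where "\<sigma> \<in> {1, - 1 :: real}" "\<And>i t. i \<in> {1..s} \<Longrightarrow> t \<in> I \<Longrightarrow> \<beta> i (\<gamma> t) = b t"
    "\<And>t. t \<in> I \<Longrightarrow> \<kappa> 1 t = - \<sigma> * sqrt s * b t"
    "\<And>t. t \<in> I \<Longrightarrow> (b has_real_derivative - lam t) (at t within I)"
    "\<And>t. t \<in> I \<Longrightarrow> \<zeta> (\<gamma> t) = \<sigma> *\<^sub>R sqrt s *\<^sub>R E 2 t"
proof -
  obtain H Z where H: "has_cov_deriv vel H" and Z: "has_cov_deriv H Z"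
    and normal: "\<And>t. t \<in> I \<Longrightarrow> lam t *\<^sub>R \<zeta> (\<gamma> t) = Z t - g (\<gamma> t) (Z t) (vel t) *\<^sub>R vel t"
    using par unfolding C_parallel_normal_def mean_curvature_along_def has_normal_deriv_along_def by blast
  have Z: "has_cov_deriv (\<lambda>t. \<kappa> 1 t *\<^sub>R E 2 t) Z"
    by (rule has_cov_deriv_cong[OF Z has_cov_deriv_unique[OF H cov_deriv_vel] refl])
  \<comment> \<open>A Frenet curve comes with positive curvature functions and no regularity of
    them. Differentiability is extracted from that of the product
    \<open>\<kappa> 1 t *\<^sub>R E 2 t\<close>.\<close>
  have "\<kappa> 1 differentiable (at t within I)" if "t \<in> I" for t
    using has_cov_deriv_differentiable[OF Z that]
    by (intro factor_along_differentiable[OF cov_deriv_E2 that E2_nonzero[OF that]]) simp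
  then obtain k' where k': "\<And>t. t \<in> I \<Longrightarrow> (\<kappa> 1 has_real_derivative k' t) (at t within I)"
    unfolding real_differentiable_def by metis
  have zeta: "lam t *\<^sub>R \<zeta> (\<gamma> t) = k' t *\<^sub>R E 2 t" if t: "t \<in> I" for t
  proof -
    have Zt: "Z t = k' t *\<^sub>R E 2 t + \<kappa> 1 t *\<^sub>R (- \<kappa> 1 t *\<^sub>R vel t)"
      by (rule has_cov_deriv_unique[OF Z normal_deriv_mean_curvature(1)[OF k'] t])
    show ?thesis
      unfolding normal[OF t] Zt by (rule normal_deriv_mean_curvature(2)[OF k' t])
  qed
  define h where "h t = k' t / lam t" for t
  have zeta_h: "\<zeta> (\<gamma> t) = h t *\<^sub>R E 2 t" if t: "t \<in> I" for t
  proof -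
    have "(1 / lam t) *\<^sub>R lam t *\<^sub>R \<zeta> (\<gamma> t) = (1 / lam t) *\<^sub>R k' t *\<^sub>R E 2 t"
      using zeta[OF t] by argo
    then show ?thesis using lam t by (simp add: h_def)
  qed
  \<comment> \<open>Compare squared lengths: \<open>\<zeta>\<close> is a sum of \<open>s\<close>
    orthonormal vectors and E_2 is a unit vector.\<close>
  have h_sq: "(h t)\<^sup>2 = s" if t: "t \<in> I" for t
    using g_zeta_zeta[of "\<gamma> t", unfolded zeta_h[OF t]] E2_tangent[OF t] frenet_facts(2)[OF t]
    by (simp add: power2_eq_square)
  \<comment> \<open>The sign of \<open>h\<close> could still jump with \<open>t\<close>. Continuity
    of \<open>h\<close> as the factor between two differentiable fields, together with its two
    possible values, makes it constant on the interval.\<close>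
  have "h differentiable (at t within I)" if t: "t \<in> I" for t
  proof (rule factor_along_differentiable[OF cov_deriv_E2 t E2_nonzero[OF t]])
    fix c assume c: "c \<in> A" "\<gamma> t \<in> chart_dom c"
    have "(\<lambda>u. \<Sum>i=1..s. \<xi> i (\<gamma> u) c) differentiable (at t within I)"
      using smooth_vector_field_along_has_derivative[OF c(1) t c(2) xi_smooth] differentiableI_vector
      by (intro differentiable_sum) blast+
    moreover have "(\<Sum>i=1..s. \<xi> i (\<gamma> u) c) = h u *\<^sub>R E 2 u c" if "u \<in> I" for u
      using arg_cong[OF zeta_h[OF that], of "\<lambda>v. v c"] by (simp add: fun_sum_apply)
    ultimately show "(\<lambda>u. h u *\<^sub>R E 2 u c) differentiable (at t within I)"
      by (rule differentiable_transform_within[OF _ zero_less_one t])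
  qed
  then have "continuous_on I h"
    by (simp add: continuous_on_eq_continuous_within differentiable_imp_continuous_within)
  moreover have "connected I"
    using smooth_curve unfolding smooth_curve_def nondegenerate_interval_def by (simp add: is_interval_connected_1)
  moreover have "h ` I \<subseteq> {sqrt s, - sqrt s}"
  proof (rule image_subsetI)
    fix t assume "t \<in> I"
    then show "h t \<in> {sqrt s, - sqrt s}"
      using real_sqrt_abs[of "h t"] by (auto simp: h_sq abs_if split: if_splits)
  qed
  then have "finite (h ` I)" by (rule finite_subset) simp
  ultimately have "h constant_on I"
    using continuous_finite_range_constant by blast
  then obtain a where a: "\<And>t. t \<in> I \<Longrightarrow> h t = a"
    unfolding constant_on_def by blast
  obtain t\<^sub>0 where "t\<^sub>0 \<in> I"
    using smooth_curve unfolding smooth_curve_def nondegenerate_interval_def by blast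
  then have "a\<^sup>2 = s" using h_sq a by metis
  then have "a \<noteq> 0" using s_pos by auto
  have "\<bar>a\<bar> = sqrt s" using \<open>a\<^sup>2 = s\<close> real_sqrt_abs by metis
  then have \<sigma>: "sgn a \<in> {1, - 1}" "sgn a * sqrt s = a"
    using \<open>a \<noteq> 0\<close> by (auto simp: sgn_if abs_if)
  show ?thesis
  \<comment> \<open>With \<open>a\<close> equal to \<open>sgn a * sqrt s\<close>, the formula for
    the curvature dictates this \<open>b\<close>; its derivative is -\<lambda> because \<kappa>' = a
    \<lambda> by the definition of \<open>h\<close>.\<close>
  proof (rule that[of "sgn a" "\<lambda>t. - \<kappa> 1 t / a", OF \<sigma>(1)])
    fix t assume t: "t \<in> I"
    show "\<kappa> 1 t = - sgn a * sqrt s * (- \<kappa> 1 t / a)"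
      using \<sigma>(2) \<open>a \<noteq> 0\<close> by simp
    show "\<zeta> (\<gamma> t) = sgn a *\<^sub>R sqrt s *\<^sub>R E 2 t"
      using zeta_h[OF t] a[OF t] \<sigma>(2) by simp
    have "- k' t / a = - lam t"
      using a[OF t] \<open>a \<noteq> 0\<close> lam t by (auto simp: h_def field_simps)
    then show "((\<lambda>t. - \<kappa> 1 t / a) has_real_derivative - lam t) (at t within I)"
      using DERIV_cdivide[OF DERIV_minus[OF k'[OF t]], of a] by simp
    fix i assume i: "i \<in> {1..s}"
    \<comment> \<open>Pairing \<open>\<zeta>\<close> with \<open>\<xi> i\<close> gives 1 for every
      \<open>i\<close>. Inserted into \<open>curvature_beta\<close>, this gives all
      \<open>\<beta> i\<close> the same value along the curve.\<close>
    have "a * g (\<gamma> t) (E 2 t) (\<xi> i (\<gamma> t)) = 1"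
      using g_zeta_xi[OF i, of "\<gamma> t"] zeta_h[OF t] a[OF t] E2_tangent[OF t] xi_tangent[OF i] by simp
    then have "a * (\<kappa> 1 t * g (\<gamma> t) (E 2 t) (\<xi> i (\<gamma> t))) = \<kappa> 1 t"
      by (simp add: mult.left_commute)
    then show "\<beta> i (\<gamma> t) = - \<kappa> 1 t / a"
      using curvature_beta[OF t i] \<open>a \<noteq> 0\<close> by (simp add: field_simps eq_neg_iff_add_eq_0) algebra
  qed
qed

lemma C_parallel_if:
  assumes lam: "\<forall>t\<in>I. lam t \<noteq> 0" and \<sigma>: "\<sigma> \<in> {1, - 1 :: real}"
    and b: "\<And>i t. i \<in> {1..s} \<Longrightarrow> t \<in> I \<Longrightarrow> \<beta> i (\<gamma> t) = b t"
      "\<And>t. t \<in> I \<Longrightarrow> (b has_real_derivative - lam t) (at t within I)"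
    and \<kappa>: "\<And>t. t \<in> I \<Longrightarrow> \<kappa> 1 t = - \<sigma> * sqrt s * b t"
    and zeta: "\<And>t. t \<in> I \<Longrightarrow> \<zeta> (\<gamma> t) = \<sigma> *\<^sub>R sqrt s *\<^sub>R E 2 t"
  shows "C_parallel_normal A s \<xi> g I \<gamma> lam"
proof -
  have s: "1 \<in> {1..s}" using s_pos by simp
  \<comment> \<open>Having a derivative does not make \<open>b\<close> twice differentiable. It is
    replaced by the restriction of the smooth function \<open>\<beta> 1\<close>, an index that
    exists because \<open>s\<close> is at least 1.\<close>
  have "((\<lambda>u. \<beta> 1 (\<gamma> u)) has_real_derivative - lam t) (at t within I)" if t: "t \<in> I" for t
    using b(1)[OF s] b(2)[OF t] by (rule real_derivative_transform[OF t])
  then have "(\<lambda>t. - lam t) differentiable_on I"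
    by (rule derivative_of_smooth_function_along_differentiable[OF beta_smooth[OF s]])
  then have "lam differentiable_on I"
    using differentiable_on_minus by fastforce
  let ?k' = "\<lambda>t. \<sigma> * sqrt s * lam t"
  have k': "(\<kappa> 1 has_real_derivative ?k' t) (at t within I)" if t: "t \<in> I" for t
  proof -
    have "((\<lambda>t. - \<sigma> * sqrt s * b t) has_real_derivative ?k' t) (at t within I)"
      using DERIV_cmult[OF b(2)[OF t], of "- \<sigma> * sqrt s"] by simp
    with \<kappa> show ?thesis
      by (rule real_derivative_transform[OF t])
  qed
  note N = normal_deriv_mean_curvature[of ?k', OF k']
  \<comment> \<open>The normal derivative of the mean curvature field is
    \<open>?k' t *\<^sub>R E 2 t\<close>, so this equation is the C-parallel condition.\<close>
  have zeta': "lam t *\<^sub>R \<zeta> (\<gamma> t) = ?k' t *\<^sub>R E 2 t" if "t \<in> I" for t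
    unfolding zeta[OF that] by (simp add: mult_ac)
  have "has_normal_deriv_along A g I \<gamma> (\<lambda>t. \<kappa> 1 t *\<^sub>R E 2 t) (\<lambda>t. lam t *\<^sub>R \<zeta> (\<gamma> t))"
    unfolding has_normal_deriv_along_def
    by (intro exI conjI ballI, rule N(1)) (simp_all only: zeta' N(2))
  then show ?thesis
    unfolding C_parallel_normal_def mean_curvature_along_def
    using cov_deriv_vel lam \<open>lam differentiable_on I\<close> by blast
qed

end

text \<open>The value 1 of \<open>\<sigma>\<close> stands for the upper signs and -1 for the lower
  ones. It is chosen before \<open>t\<close>, so the signs are the same along the whole curve. The
  function \<open>b\<close> is the common restriction of all \<beta>_i, and \<lambda> = -\<beta>' is
  expressed by its derivative within \<open>I\<close>.\<close>

theorem theorem3: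
  fixes A :: "('a::{t2_space,second_countable_topology}, 'm::finite) chart set"
    and n s :: nat
    and f :: "'a \<Rightarrow> ('a, 'm) tvec \<Rightarrow> ('a, 'm) tvec"
    and \<xi> :: "nat \<Rightarrow> 'a \<Rightarrow> ('a, 'm) tvec"
    and \<eta> :: "nat \<Rightarrow> 'a \<Rightarrow> ('a, 'm) tvec \<Rightarrow> real"
    and g :: "'a \<Rightarrow> ('a, 'm) tvec \<Rightarrow> ('a, 'm) tvec \<Rightarrow> real"
    and \<alpha> \<beta> :: "nat \<Rightarrow> 'a \<Rightarrow> real"
    and I :: "real set" and \<gamma> :: "real \<Rightarrow> 'a"
    and E :: "nat \<Rightarrow> real \<Rightarrow> ('a, 'm) tvec" and \<kappa> :: "nat \<Rightarrow> real \<Rightarrow> real"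
    and lam :: "real \<Rightarrow> real"
  assumes "trans_S_manifold A n s f \<xi> \<eta> g \<alpha> \<beta>"
    and "frenet_curve A g I \<gamma> 2 E \<kappa>"
    and "legendre_curve A s \<eta> I \<gamma>"
    and "\<forall>t\<in>I. lam t \<noteq> 0"
  shows "C_parallel_normal A s \<xi> g I \<gamma> lam \<longleftrightarrow>
    (\<exists>b :: real \<Rightarrow> real.
       (\<forall>i\<in>{1..s}. \<forall>t\<in>I. \<beta> i (\<gamma> t) = b t) \<and>
       (\<exists>\<sigma>\<in>{1, -1 :: real}. \<forall>t\<in>I.
          \<kappa> 1 t = - \<sigma> * sqrt s * b t \<and>
          (b has_real_derivative - lam t) (at t within I) \<and>
          (\<Sum>i=1..s. \<xi> i (\<gamma> t)) = \<sigma> *\<^sub>R sqrt s *\<^sub>R E 2 t))"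
  (is "_ \<longleftrightarrow> ?R")
proof -
  interpret legendre_curve_in_trans_S_manifold A n s f \<xi> \<eta> g \<alpha> \<beta> I \<gamma> E \<kappa>
    using assms(1-3) by unfold_locales
  show ?thesis
  proof
    assume "C_parallel_normal A s \<xi> g I \<gamma> lam"
    then obtain \<sigma> b where "\<sigma> \<in> {1, - 1 :: real}" "\<And>i t. i \<in> {1..s} \<Longrightarrow> t \<in> I \<Longrightarrow> \<beta> i (\<gamma> t) = b t"
      "\<And>t. t \<in> I \<Longrightarrow> \<kappa> 1 t = - \<sigma> * sqrt s * b t"
      "\<And>t. t \<in> I \<Longrightarrow> (b has_real_derivative - lam t) (at t within I)"
      "\<And>t. t \<in> I \<Longrightarrow> \<zeta> (\<gamma> t) = \<sigma> *\<^sub>R sqrt s *\<^sub>R E 2 t"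
      using C_parallel_imp[OF assms(4)] by blast
    then show ?R
      by (intro exI[of _ b] conjI bexI[of _ \<sigma>] ballI)
  next
    assume ?R
    then obtain b \<sigma> where "\<forall>i\<in>{1..s}. \<forall>t\<in>I. \<beta> i (\<gamma> t) = b t" and \<sigma>: "\<sigma> \<in> {1, - 1 :: real}"
      and "\<forall>t\<in>I. \<kappa> 1 t = - \<sigma> * sqrt s * b t \<and> (b has_real_derivative - lam t) (at t within I)
        \<and> \<zeta> (\<gamma> t) = \<sigma> *\<^sub>R sqrt s *\<^sub>R E 2 t"
      by blast
    then show "C_parallel_normal A s \<xi> g I \<gamma> lam"
      by (intro C_parallel_if[OF assms(4) \<sigma>]) blast+
  qed
qed

end
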